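(* Let $X$ be a Tychonoff space and let $L(X)$ be the free locally convex space over $X$. The following assertions are equivalent: (i) $L(X)$ is $\ell_\infty$-barrelled; (ii) $L(X)$ is $\ell_\infty$-quasibarrelled; (iii) $L(X)$ is $c_0$-barrelled; (iv) $L(X)$ is $\aleph_0$-quasibarrelled; (v) $X$ is a $P$-space.
   Context: Locally convex spaces (lcs) are real and Hausdorff; Tychonoff means completely regular and Hausdorff. The free locally convex space over a Tychonoff space $X$ is an lcs $L(X)$ with a continuous map $i:X\to L(X)$ such that for every continuous map $f$ from $X$ to an lcs $E$ there is a unique continuous linear operator $\bar f:L(X)\to E$ with $f=\bar f\circ i$. It exists and is essentially unique, and $i$ is a topological embedding whose image is a Hamel basis of $L(X)$. For an lcs $E$ with topological dual $E'$, $\sigma(E',E)$ is the weak-$*$ topology and $\beta(E',E)$ the strong topology (uniform convergence on bounded subsets of $E$). A subset of $E'$ is equicontinuous if it is contained in the polar $U^\circ=\{\chi\in E':|\chi(x)|\le 1\ \forall x\in U\}$ of some neighborhood $U$ of zero in $E$. An lcs $E$ is: $\ell_\infty$-barrelled if every $\sigma(E',E)$-bounded sequence in $E'$ is equicontinuous; $\ell_\infty$-quasibarrelled if every $\beta(E',E)$-bounded sequence in $E'$ is equicontinuous; $c_0$-barrelled if every $\sigma(E',E)$-null sequence in $E'$ is equicontinuous; $\aleph_0$-quasibarrelled if every $\beta(E',E)$-bounded subset of $E'$ which is a countable union of equicontinuous sets is itself equicontinuous. A topological space is a $P$-space if every countable intersection of open sets is open. *)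

theory Defs
  imports "HOL-Analysis.Analysis" "HOL-Library.Function_Algebras"
begin

section \<open>Function spaces as real vector spaces\<close>

text \<open>The topological dual of a space over \<open>'v\<close> lives in \<open>'v \<Rightarrow> real\<close>, with pointwise operations.\<close>

instantiation "fun" :: (type, real_vector) real_vector
begin

definition scaleR_fun :: "real \<Rightarrow> ('a \<Rightarrow> 'b) \<Rightarrow> 'a \<Rightarrow> 'b"
  where "scaleR_fun c f = (\<lambda>x. c *\<^sub>R f x)"

instance
  by standard (auto simp: scaleR_fun_def fun_eq_iff algebra_simps)

end

lemma scaleR_fun_apply [simp]: "(c *\<^sub>R f) x = c *\<^sub>R f x"
  by (simp add: scaleR_fun_def)


section \<open>Locally convex spaces\<close>

text \<open>A locally convex space is given by its topology \<open>E\<close>; the underlying vector space is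
  \<open>topspace E\<close>, a linear subspace of the ambient type.\<close>

definition tvs :: "'v::real_vector topology \<Rightarrow> bool"
  where "tvs E \<longleftrightarrow> subspace (topspace E)
    \<and> continuous_map (prod_topology E E) E (\<lambda>(x, y). x + y)
    \<and> continuous_map (prod_topology euclideanreal E) E (\<lambda>(c, x). c *\<^sub>R x)"

definition lcs :: "'v::real_vector topology \<Rightarrow> bool"
  where "lcs E \<longleftrightarrow> tvs E \<and> Hausdorff_space E \<and> neighbourhood_base_at 0 convex E"

definition nbhd_zero :: "'v::real_vector topology \<Rightarrow> 'v set \<Rightarrow> bool"
  where "nbhd_zero E U \<longleftrightarrow> U \<subseteq> topspace E \<and> (\<exists>W. openin E W \<and> 0 \<in> W \<and> W \<subseteq> U)"

definition bounded_in :: "'v::real_vector topology \<Rightarrow> 'v set \<Rightarrow> bool"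
  where "bounded_in E B \<longleftrightarrow> B \<subseteq> topspace E
    \<and> (\<forall>U. nbhd_zero E U \<longrightarrow> (\<exists>s>0. \<forall>t\<ge>s. B \<subseteq> (\<lambda>x. t *\<^sub>R x) ` U))"

text \<open>Continuous linear operators, normalised to vanish outside the carrier of the domain, so that
  two of them are equal as soon as they agree on it.\<close>

definition clin :: "'v::real_vector topology \<Rightarrow> 'w::real_vector topology \<Rightarrow> ('v \<Rightarrow> 'w) set"
  where "clin E F = {g. continuous_map E F g
    \<and> (\<forall>x\<in>topspace E. \<forall>y\<in>topspace E. g (x + y) = g x + g y)
    \<and> (\<forall>c. \<forall>x\<in>topspace E. g (c *\<^sub>R x) = c *\<^sub>R g x)
    \<and> (\<forall>x. x \<notin> topspace E \<longrightarrow> g x = 0)}"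

definition dual :: "'v::real_vector topology \<Rightarrow> ('v \<Rightarrow> real) set"
  where "dual E = clin E euclideanreal"


section \<open>Topologies on the dual\<close>

text \<open>Since functionals vanish outside \<open>topspace E\<close>, the product over all of \<open>UNIV\<close> induces pointwise
  convergence on \<open>E\<close>.\<close>

definition weak_star :: "'v::real_vector topology \<Rightarrow> ('v \<Rightarrow> real) topology"
  where "weak_star E = subtopology (product_topology (\<lambda>_. euclideanreal) UNIV) (dual E)"

definition strong_open :: "'v::real_vector topology \<Rightarrow> ('v \<Rightarrow> real) set \<Rightarrow> bool"
  where "strong_open E U \<longleftrightarrow> U \<subseteq> dual E \<and> (\<forall>\<phi>\<in>U. \<exists>B r. bounded_in E B \<and> r > 0
    \<and> {\<psi> \<in> dual E. \<forall>x\<in>B. \<bar>\<psi> x - \<phi> x\<bar> \<le> r} \<subseteq> U)"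

definition strong :: "'v::real_vector topology \<Rightarrow> ('v \<Rightarrow> real) topology"
  where "strong E = topology (strong_open E)"

lemma bounded_in_Un:
  assumes "bounded_in E A" "bounded_in E B"
  shows "bounded_in E (A \<union> B)"
  unfolding bounded_in_def
proof (intro conjI allI impI)
  show "A \<union> B \<subseteq> topspace E" using assms by (auto simp: bounded_in_def)
  fix U assume U: "nbhd_zero E U"
  obtain s t where "s > 0" "\<forall>r\<ge>s. A \<subseteq> (\<lambda>x. r *\<^sub>R x) ` U" "t > 0" "\<forall>r\<ge>t. B \<subseteq> (\<lambda>x. r *\<^sub>R x) ` U"
    using assms U unfolding bounded_in_def by meson
  then show "\<exists>s>0. \<forall>t\<ge>s. A \<union> B \<subseteq> (\<lambda>x. t *\<^sub>R x) ` U"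
    by (intro exI[of _ "max s t"]) auto
qed

lemma bounded_in_empty: "bounded_in E {}"
  by (auto simp: bounded_in_def intro: exI[of _ 1])

lemma istopology_strong_open: "istopology (strong_open E)"
  unfolding istopology_def
proof (intro conjI allI impI)
  fix S T assume S: "strong_open E S" and T: "strong_open E T"
  show "strong_open E (S \<inter> T)"
    unfolding strong_open_def
  proof (intro conjI ballI)
    show "S \<inter> T \<subseteq> dual E" using S by (auto simp: strong_open_def)
    fix \<phi> assume "\<phi> \<in> S \<inter> T"
    then obtain A B d e where *: "bounded_in E A" "d > 0"
        "{\<psi> \<in> dual E. \<forall>x\<in>A. \<bar>\<psi> x - \<phi> x\<bar> \<le> d} \<subseteq> S"
        "bounded_in E B" "e > 0" "{\<psi> \<in> dual E. \<forall>x\<in>B. \<bar>\<psi> x - \<phi> x\<bar> \<le> e} \<subseteq> T"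
      using S T unfolding strong_open_def by (meson IntD1 IntD2)
    moreover have "{\<psi> \<in> dual E. \<forall>x\<in>A \<union> B. \<bar>\<psi> x - \<phi> x\<bar> \<le> min d e} \<subseteq> S \<inter> T"
      using * by fastforce
    ultimately show "\<exists>B r. bounded_in E B \<and> r > 0
        \<and> {\<psi> \<in> dual E. \<forall>x\<in>B. \<bar>\<psi> x - \<phi> x\<bar> \<le> r} \<subseteq> S \<inter> T"
      by (intro exI[of _ "A \<union> B"] exI[of _ "min d e"]) (auto intro: bounded_in_Un)
  qed
next
  fix \<K> assume K: "\<forall>K\<in>\<K>. strong_open E K"
  show "strong_open E (\<Union>\<K>)"
    unfolding strong_open_def
  proof (intro conjI ballI)
    show "\<Union>\<K> \<subseteq> dual E" using K by (auto simp: strong_open_def)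
    fix \<phi> assume "\<phi> \<in> \<Union>\<K>"
    then obtain K where "K \<in> \<K>" "\<phi> \<in> K" by auto
    then show "\<exists>B r. bounded_in E B \<and> r > 0
        \<and> {\<psi> \<in> dual E. \<forall>x\<in>B. \<bar>\<psi> x - \<phi> x\<bar> \<le> r} \<subseteq> \<Union>\<K>"
      using K unfolding strong_open_def by (meson Union_upper subset_trans)
  qed
qed

lemma openin_strong: "openin (strong E) U \<longleftrightarrow> strong_open E U"
  by (simp add: strong_def topology_inverse'[OF istopology_strong_open])

lemma topspace_weak_star [simp]: "topspace (weak_star E) = dual E"
  by (simp add: weak_star_def)

lemma topspace_strong [simp]: "topspace (strong E) = dual E"
proof -
  have "strong_open E (dual E)"
    unfolding strong_open_def using bounded_in_empty zero_less_one by blast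
  then show ?thesis
    by (auto simp: topspace_def openin_strong) (auto simp: strong_open_def)
qed

definition polar :: "'v::real_vector topology \<Rightarrow> 'v set \<Rightarrow> ('v \<Rightarrow> real) set"
  where "polar E U = {\<phi> \<in> dual E. \<forall>x\<in>U. \<bar>\<phi> x\<bar> \<le> 1}"

definition equicontinuous :: "'v::real_vector topology \<Rightarrow> ('v \<Rightarrow> real) set \<Rightarrow> bool"
  where "equicontinuous E A \<longleftrightarrow> (\<exists>U. nbhd_zero E U \<and> A \<subseteq> polar E U)"


section \<open>Weak barrelledness conditions\<close>

definition linf_barrelled :: "'v::real_vector topology \<Rightarrow> bool"
  where "linf_barrelled E \<longleftrightarrow> (\<forall>\<phi> :: nat \<Rightarrow> 'v \<Rightarrow> real.
    bounded_in (weak_star E) (range \<phi>) \<longrightarrow> equicontinuous E (range \<phi>))"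

definition linf_quasibarrelled :: "'v::real_vector topology \<Rightarrow> bool"
  where "linf_quasibarrelled E \<longleftrightarrow> (\<forall>\<phi> :: nat \<Rightarrow> 'v \<Rightarrow> real.
    bounded_in (strong E) (range \<phi>) \<longrightarrow> equicontinuous E (range \<phi>))"

definition c0_barrelled :: "'v::real_vector topology \<Rightarrow> bool"
  where "c0_barrelled E \<longleftrightarrow> (\<forall>\<phi> :: nat \<Rightarrow> 'v \<Rightarrow> real.
    range \<phi> \<subseteq> dual E \<and> limitin (weak_star E) \<phi> 0 sequentially \<longrightarrow> equicontinuous E (range \<phi>))"

definition aleph0_quasibarrelled :: "'v::real_vector topology \<Rightarrow> bool"
  where "aleph0_quasibarrelled E \<longleftrightarrow> (\<forall>A :: nat \<Rightarrow> ('v \<Rightarrow> real) set.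
    (\<forall>n. equicontinuous E (A n)) \<and> bounded_in (strong E) (\<Union>n. A n)
      \<longrightarrow> equicontinuous E (\<Union>n. A n))"


section \<open>Topological spaces\<close>

definition tychonoff_space :: "'a topology \<Rightarrow> bool"
  where "tychonoff_space X \<longleftrightarrow> completely_regular_space X \<and> Hausdorff_space X"

definition P_space :: "'a topology \<Rightarrow> bool"
  where "P_space X \<longleftrightarrow> (\<forall>U :: nat \<Rightarrow> 'a set. (\<forall>n. openin X (U n)) \<longrightarrow> openin X (\<Inter>n. U n))"


section \<open>The free locally convex space\<close>

text \<open>The universal property, tested against the locally convex spaces whose carrier lies in the
  type \<open>'e\<close>.\<close>

definition free_lcs_wrt ::
    "'e::real_vector itself \<Rightarrow> 'a topology \<Rightarrow> 'v::real_vector topology \<Rightarrow> ('a \<Rightarrow> 'v) \<Rightarrow> bool"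
  where "free_lcs_wrt _ X L i \<longleftrightarrow> lcs L \<and> continuous_map X L i
    \<and> (\<forall>(E :: 'e topology) f. lcs E \<and> continuous_map X E f
          \<longrightarrow> (\<exists>!g. g \<in> clin L E \<and> (\<forall>x\<in>topspace X. g (i x) = f x)))"

text \<open>A formula cannot quantify over all types \<open>'e\<close>. The single type \<open>'v \<times> real\<close> suffices:
  \<open>free_lcs_universal\<close> below derives the universal property for every type, and \<open>free_lcs_exists\<close>
  shows that every Tychonoff space has a free locally convex space. (The type \<open>'v\<close> alone would not
  do: if it is trivial, there are no nonzero test spaces in it.)\<close>

definition free_lcs :: "'a topology \<Rightarrow> 'v::real_vector topology \<Rightarrow> ('a \<Rightarrow> 'v) \<Rightarrow> bool"
  where "free_lcs X L i \<longleftrightarrow> free_lcs_wrt TYPE('v \<times> real) X L i"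


subsection \<open>Adequacy of the definition\<close>

lemma tvs_add:
  assumes "tvs E" "continuous_map Z E f" "continuous_map Z E g"
  shows "continuous_map Z E (\<lambda>z. f z + g z)"
  using continuous_map_compose[OF continuous_map_pairedI[OF assms(2,3)], of E "\<lambda>(x, y). x + y"]
    assms(1) by (simp add: tvs_def o_def)

lemma tvs_scaleR:
  assumes "tvs E" "continuous_map Z euclideanreal c" "continuous_map Z E f"
  shows "continuous_map Z E (\<lambda>z. c z *\<^sub>R f z)"
  using continuous_map_compose[OF continuous_map_pairedI[OF assms(2,3)], of E "\<lambda>(c, x). c *\<^sub>R x"]
    assms(1) by (simp add: tvs_def o_def)

lemma lcs_subspace: "lcs E \<Longrightarrow> subspace (topspace E)"
  by (simp add: lcs_def tvs_def)

lemma lcs_pullback: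
  assumes E: "lcs E" and V: "subspace V" and gV: "g ` V \<subseteq> topspace E" and inj: "inj_on g V"
    and add: "\<And>x y. x \<in> V \<Longrightarrow> y \<in> V \<Longrightarrow> g (x + y) = g x + g y"
    and scale: "\<And>c x. x \<in> V \<Longrightarrow> g (c *\<^sub>R x) = c *\<^sub>R g x"
  shows "lcs (pullback_topology V g E)" and "topspace (pullback_topology V g E) = V"
proof -
  let ?P = "pullback_topology V g E"
  have T: "tvs E" using E by (simp add: lcs_def)
  show top: "topspace ?P = V"
    using gV by (auto simp: topspace_pullback_topology)
  have g: "continuous_map ?P E g"
    using continuous_map_pullback[of E E id V g] by simp
  have fst: "continuous_map (prod_topology ?P ?P) E (\<lambda>z. g (fst z))"
    and snd: "continuous_map (prod_topology ?P ?P) E (\<lambda>z. g (snd z))"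
    using continuous_map_compose[OF continuous_map_fst g] continuous_map_compose[OF continuous_map_snd g]
    by (simp_all add: o_def)
  have "continuous_map (prod_topology ?P ?P) E (g \<circ> (\<lambda>(x, y). x + y))"
    by (rule continuous_map_eq[OF tvs_add[OF T fst snd]]) (auto simp: top add)
  then have 1: "continuous_map (prod_topology ?P ?P) ?P (\<lambda>(x, y). x + y)"
    by (rule continuous_map_pullback') (auto simp: top subspace_add[OF V])
  have snd': "continuous_map (prod_topology euclideanreal ?P) E (\<lambda>z. g (snd z))"
    using continuous_map_compose[OF continuous_map_snd g] by (simp add: o_def)
  have "continuous_map (prod_topology euclideanreal ?P) E (g \<circ> (\<lambda>(c, x). c *\<^sub>R x))"
    by (rule continuous_map_eq[OF tvs_scaleR[OF T continuous_map_fst snd']]) (auto simp: top scale)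
  then have 2: "continuous_map (prod_topology euclideanreal ?P) ?P (\<lambda>(c, x). c *\<^sub>R x)"
    by (rule continuous_map_pullback') (auto simp: top subspace_scale[OF V])
  have 3: "Hausdorff_space ?P"
    using Hausdorff_space_injective_preimage[OF _ g] E inj by (simp add: top lcs_def)
  have g0: "g 0 = 0" using scale[of 0 0] subspace_0[OF V] by simp
  have 4: "neighbourhood_base_at 0 convex ?P"
    unfolding neighbourhood_base_at_def
  proof (intro allI impI)
    fix W assume "openin ?P W \<and> 0 \<in> W"
    then obtain U where U: "openin E U" "W = g -` U \<inter> V" "0 \<in> U"
      by (auto simp: openin_pullback_topology g0)
    then obtain O' C where OC: "openin E O'" "convex C" "0 \<in> O'" "O' \<subseteq> C" "C \<subseteq> U"
      using E unfolding lcs_def neighbourhood_base_at_def by blast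
    have "convex (g -` C \<inter> V)"
      unfolding convex_def using OC(2) V
      by (auto simp: add scale subspace_add subspace_scale convex_def)
    then show "\<exists>U Va. openin ?P U \<and> convex Va \<and> 0 \<in> U \<and> U \<subseteq> Va \<and> Va \<subseteq> W"
      using U OC subspace_0[OF V]
      by (intro exI[of _ "g -` O' \<inter> V"] exI[of _ "g -` C \<inter> V"])
        (auto simp: openin_pullback_topology g0)
  qed
  show "lcs ?P"
    using V 1 2 3 4 by (simp add: lcs_def tvs_def top)
qed

lemma lcs_prod:
  assumes "lcs E" "lcs F" shows "lcs (prod_topology E F)"
proof -
  let ?P = "prod_topology E F"
  have T: "tvs E" "tvs F" using assms by (auto simp: lcs_def)
  have c: "continuous_map (prod_topology ?P ?P) E (\<lambda>z. fst (fst z))"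
     "continuous_map (prod_topology ?P ?P) F (\<lambda>z. snd (fst z))"
     "continuous_map (prod_topology ?P ?P) E (\<lambda>z. fst (snd z))"
     "continuous_map (prod_topology ?P ?P) F (\<lambda>z. snd (snd z))"
    using continuous_map_compose[OF continuous_map_fst continuous_map_fst, of E F ?P]
      continuous_map_compose[OF continuous_map_fst continuous_map_snd, of E F ?P]
      continuous_map_compose[OF continuous_map_snd continuous_map_fst, of ?P E F]
      continuous_map_compose[OF continuous_map_snd continuous_map_snd, of ?P E F]
    unfolding o_def .
  have d: "continuous_map (prod_topology euclideanreal ?P) E (\<lambda>z. fst (snd z))"
     "continuous_map (prod_topology euclideanreal ?P) F (\<lambda>z. snd (snd z))"
    using continuous_map_compose[OF continuous_map_snd continuous_map_fst, of euclideanreal E F]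
      continuous_map_compose[OF continuous_map_snd continuous_map_snd, of euclideanreal E F]
    unfolding o_def .
  have 1: "continuous_map (prod_topology ?P ?P) ?P (\<lambda>(x, y). x + y)"
    using continuous_map_pairedI[OF tvs_add[OF T(1) c(1,3)] tvs_add[OF T(2) c(2,4)]]
    by (simp add: case_prod_unfold plus_prod_def)
  have 2: "continuous_map (prod_topology euclideanreal ?P) ?P (\<lambda>(c, x). c *\<^sub>R x)"
    using continuous_map_pairedI[OF tvs_scaleR[OF T(1) continuous_map_fst d(1)]
        tvs_scaleR[OF T(2) continuous_map_fst d(2)]]
    by (simp add: case_prod_unfold scaleR_prod_def)
  have 4: "neighbourhood_base_at 0 convex ?P"
    unfolding neighbourhood_base_at_def
  proof (intro allI impI)
    fix W assume "openin ?P W \<and> 0 \<in> W"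
    then obtain U V where UV: "openin E U" "openin F V" "0 \<in> U" "0 \<in> V" "U \<times> V \<subseteq> W"
      unfolding openin_prod_topology_alt zero_prod_def by blast
    then obtain A B C D where "openin E A" "convex C" "0 \<in> A" "A \<subseteq> C" "C \<subseteq> U"
        "openin F B" "convex D" "0 \<in> B" "B \<subseteq> D" "D \<subseteq> V"
      using assms unfolding lcs_def neighbourhood_base_at_def by meson
    with UV show "\<exists>U V. openin ?P U \<and> convex V \<and> 0 \<in> U \<and> U \<subseteq> V \<and> V \<subseteq> W"
      by (intro exI[of _ "A \<times> B"] exI[of _ "C \<times> D"])
        (auto simp: openin_prod_Times_iff zero_prod_def convex_Times)
  qed
  show ?thesis
    using 1 2 4 assms
    by (auto simp: lcs_def tvs_def subspace_Times Hausdorff_space_prod_topology)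
qed

lemma lcs_product:
  assumes "\<And>k. lcs (E k)" shows "lcs (product_topology E UNIV)"
proof -
  let ?P = "product_topology E UNIV"
  have T: "tvs (E k)" for k using assms by (auto simp: lcs_def)
  have S: "subspace (topspace (E k))" for k using assms by (rule lcs_subspace)
  have 0: "subspace (topspace ?P)"
    by (rule subspaceI)
      (simp_all add: PiE_UNIV_domain Pi_iff subspace_0[OF S] subspace_add[OF S] subspace_scale[OF S])
  have p: "continuous_map ?P (E k) (\<lambda>x. x k)" for k
    by (simp add: continuous_map_product_projection)
  have p': "continuous_map (prod_topology ?P ?P) (E k) (\<lambda>z. fst z k)"
      "continuous_map (prod_topology ?P ?P) (E k) (\<lambda>z. snd z k)"
      "continuous_map (prod_topology euclideanreal ?P) (E k) (\<lambda>z. snd z k)" for k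
    using continuous_map_compose[OF continuous_map_fst p[of k]]
      continuous_map_compose[OF continuous_map_snd p[of k]]
    unfolding o_def by blast+
  have 1: "continuous_map (prod_topology ?P ?P) ?P (\<lambda>(x, y). x + y)"
    using tvs_add[OF T p'(1,2)] by (simp add: continuous_map_componentwise_UNIV case_prod_unfold)
  have 2: "continuous_map (prod_topology euclideanreal ?P) ?P (\<lambda>(c, x). c *\<^sub>R x)"
    using tvs_scaleR[OF T continuous_map_fst p'(3)]
    by (simp add: continuous_map_componentwise_UNIV case_prod_unfold)
  have 4: "neighbourhood_base_at 0 convex ?P"
    unfolding neighbourhood_base_at_def
  proof (intro allI impI)
    fix W assume "openin ?P W \<and> 0 \<in> W"
    then obtain U where U: "finite {k. U k \<noteq> topspace (E k)}" "\<And>k. openin (E k) (U k)"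
        "0 \<in> Pi\<^sub>E UNIV U" "Pi\<^sub>E UNIV U \<subseteq> W"
      unfolding openin_product_topology_alt by (metis (no_types, lifting) UNIV_I Collect_cong)
    have "\<exists>A C. openin (E k) A \<and> convex C \<and> 0 \<in> A \<and> A \<subseteq> C \<and> C \<subseteq> U k
        \<and> (U k = topspace (E k) \<longrightarrow> A = topspace (E k))" for k
    proof (cases "U k = topspace (E k)")
      case True
      then show ?thesis
        using subspace_imp_convex[OF S[of k]] subspace_0[OF S[of k]]
        by (intro exI[of _ "topspace (E k)"]) auto
    next
      case False
      have "0 \<in> U k" using U(3) by (auto simp: PiE_iff)
      then show ?thesis
        using False assms[of k] U(2)[of k] unfolding lcs_def neighbourhood_base_at_def by meson
    qed
    then obtain A C where AC: "\<And>k. openin (E k) (A k)" "\<And>k. convex (C k)" "\<And>k. 0 \<in> A k"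
        "\<And>k. A k \<subseteq> C k" "\<And>k. C k \<subseteq> U k" "\<And>k. U k = topspace (E k) \<Longrightarrow> A k = topspace (E k)"
      by metis
    have "finite {k. A k \<noteq> topspace (E k)}"
      by (rule finite_subset[OF _ U(1)]) (use AC(6) in auto)
    then have "openin ?P (Pi\<^sub>E UNIV A)"
      using AC(1) by (simp add: openin_PiE_gen)
    moreover have "convex (Pi\<^sub>E UNIV C)"
      using AC(2) by (auto simp: convex_def PiE_iff)
    moreover have "0 \<in> Pi\<^sub>E UNIV A" "Pi\<^sub>E UNIV A \<subseteq> Pi\<^sub>E UNIV C" "Pi\<^sub>E UNIV C \<subseteq> W"
      using AC(3) PiE_mono[of UNIV A C] AC(4) subset_trans[OF PiE_mono[of UNIV C U] U(4)] AC(5)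
      by (auto simp: PiE_iff)
    ultimately show "\<exists>U V. openin ?P U \<and> convex V \<and> 0 \<in> U \<and> U \<subseteq> V \<and> V \<subseteq> W"
      by blast
  qed
  have "Hausdorff_space ?P"
    using assms unfolding Hausdorff_space_product_topology lcs_def by blast
  then show ?thesis
    using 0 1 2 4 unfolding lcs_def tvs_def by blast
qed

lemma lcs_real: "lcs euclideanreal"
proof -
  have "continuous_map (prod_topology euclideanreal euclideanreal) euclideanreal (\<lambda>z. fst z + snd z)"
    "continuous_map (prod_topology euclideanreal euclideanreal) euclideanreal (\<lambda>z. fst z *\<^sub>R snd z)"
    by (auto intro!: continuous_intros)
  moreover have "neighbourhood_base_at (0::real) convex euclidean"
    unfolding neighbourhood_base_at_def
  proof (intro allI impI)
    fix W :: "real set" assume "openin euclidean W \<and> 0 \<in> W"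
    then obtain e where "e > 0" "ball 0 e \<subseteq> W"
      by (auto simp: open_contains_ball)
    then show "\<exists>U V. openin euclidean U \<and> convex V \<and> 0 \<in> U \<and> U \<subseteq> V \<and> V \<subseteq> W"
      by (intro exI[of _ "ball 0 e"]) (auto simp: convex_ball)
  qed
  ultimately show ?thesis
    by (simp add: lcs_def tvs_def case_prod_unfold)
qed

lemma clinI:
  assumes "continuous_map E F g" "lcs E"
    "\<And>x y. x \<in> topspace E \<Longrightarrow> y \<in> topspace E \<Longrightarrow> g (x + y) = g x + g y"
    "\<And>c x. x \<in> topspace E \<Longrightarrow> g (c *\<^sub>R x) = c *\<^sub>R g x"
  shows "(\<lambda>x. if x \<in> topspace E then g x else 0) \<in> clin E F"
proof -
  have "continuous_map E F (\<lambda>x. if x \<in> topspace E then g x else 0)"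
    by (rule continuous_map_eq[OF assms(1)]) auto
  then show ?thesis
    using assms(3,4) lcs_subspace[OF assms(2)]
    by (auto simp: clin_def subspace_add subspace_scale)
qed

lemma clin_eq_subspace:
  assumes L: "lcs L" and "g \<in> clin L E" "h \<in> clin L E"
  shows "subspace {v \<in> topspace L. g v = h v}"
proof -
  have V: "subspace (topspace L)" using L by (rule lcs_subspace)
  have *: "f (x + y) = f x + f y" "f (c *\<^sub>R x) = c *\<^sub>R f x"
    if "f \<in> clin L E" "x \<in> topspace L" "y \<in> topspace L" for f x y c
    using that by (auto simp: clin_def)
  have f0: "f 0 = 0" if "f \<in> clin L E" for f
    using *(2)[of f 0 0 0] that subspace_0[OF V] by simp
  then show ?thesis
    using assms(2,3) by (intro subspaceI) (auto simp: * f0[of g] f0[of h] subspace_0[OF V] subspace_add[OF V] subspace_scale[OF V])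
qed

lemma clin_eqI:
  assumes "g \<in> clin L E" "h \<in> clin L E" "lcs L" "topspace L = span B" "\<And>b. b \<in> B \<Longrightarrow> g b = h b"
  shows "g = h"
proof -
  have "g v = h v" if "v \<in> span B" for v
  proof -
    have "subspace {v \<in> topspace L. g v = h v}"
      using assms(1-3) by (intro clin_eq_subspace)
    moreover have "B \<subseteq> {v \<in> topspace L. g v = h v}"
      using assms(4,5) by (auto intro: span_base)
    ultimately show ?thesis
      using that span_minimal by blast
  qed
  moreover have "g v = h v" if "v \<notin> span B" for v
    using that assms by (auto simp: clin_def)
  ultimately show ?thesis by blast
qed

text \<open>The universal property passes to types that embed linearly.\<close>

lemma free_lcs_wrt_embed:
  fixes j :: "'e::real_vector \<Rightarrow> 'f::real_vector"
  assumes free: "free_lcs_wrt TYPE('f) X L i"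
    and j: "linear j" and k: "linear k" and kj: "\<And>x. k (j x) = x"
  shows "free_lcs_wrt TYPE('e) X L i"
  unfolding free_lcs_wrt_def
proof (intro conjI allI impI)
  show L: "lcs L" and i: "continuous_map X L i"
    using free by (auto simp: free_lcs_wrt_def)
  fix E :: "'e topology" and f assume A: "lcs E \<and> continuous_map X E f"
  let ?V = "j ` topspace E" let ?E = "pullback_topology ?V k E"
  have V: "subspace ?V"
    using linear_subspace_image[OF j lcs_subspace] A by blast
  have "k ` ?V \<subseteq> topspace E" "inj_on k ?V"
    by (auto simp: kj intro: inj_onI)
  then have E: "lcs ?E" and top: "topspace ?E = ?V"
    using lcs_pullback[of E ?V k] A V by (simp_all add: linear_add[OF k] linear_scale[OF k])
  have kc: "continuous_map ?E E k"
    using continuous_map_pullback[of E E id ?V k] by simp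
  have jc: "continuous_map E ?E j"
    by (rule continuous_map_pullback') (auto simp: o_def kj)
  have "continuous_map X ?E (\<lambda>x. j (f x))"
    using continuous_map_compose[OF _ jc, of X f] A by (simp add: o_def)
  then have "\<exists>!g. g \<in> clin L ?E \<and> (\<forall>x\<in>topspace X. g (i x) = j (f x))"
    using free E unfolding free_lcs_wrt_def by blast
  then obtain g where g: "g \<in> clin L ?E" "\<And>x. x \<in> topspace X \<Longrightarrow> g (i x) = j (f x)"
    and uniq: "\<And>h. h \<in> clin L ?E \<Longrightarrow> \<forall>x\<in>topspace X. h (i x) = j (f x) \<Longrightarrow> h = g"
    by blast
  have "(\<lambda>x. k (g x)) \<in> clin L E"
    using g(1) continuous_map_compose[OF _ kc, of L g]
    by (auto simp: clin_def o_def linear_add[OF k] linear_scale[OF k] linear_0[OF k])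
  moreover have "k (g (i x)) = f x" if "x \<in> topspace X" for x
    using g(2)[OF that] kj by simp
  moreover have "h = (\<lambda>x. k (g x))" if h: "h \<in> clin L E" "\<forall>x\<in>topspace X. h (i x) = f x" for h
  proof -
    have "(\<lambda>x. j (h x)) \<in> clin L ?E"
      using h(1) continuous_map_compose[OF _ jc, of L h]
      by (auto simp: clin_def o_def linear_add[OF j] linear_scale[OF j] linear_0[OF j])
    then have "(\<lambda>x. j (h x)) = g"
      by (rule uniq) (use h(2) in auto)
    then show ?thesis
      using kj by auto
  qed
  ultimately show "\<exists>!g. g \<in> clin L E \<and> (\<forall>x\<in>topspace X. g (i x) = f x)"
    by (intro ex1I[of _ "\<lambda>x. k (g x)"]) blast+
qed

lemma tychonoff_separate:
  assumes "tychonoff_space X" "finite S" "S \<subseteq> topspace X" "x \<in> topspace X" "x \<notin> S"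
  obtains g where "continuous_map X euclideanreal g" "g x = 1" "\<And>y. y \<in> S \<Longrightarrow> g y = 0"
proof -
  have "closedin X S"
    using assms by (simp add: tychonoff_space_def closedin_Hausdorff_finite)
  then obtain h where h: "continuous_map X euclideanreal h" "h x = 0" "h ` S \<subseteq> {1}"
    using assms unfolding tychonoff_space_def completely_regular_space_alt by blast
  show ?thesis
    by (rule that[of "\<lambda>y. 1 - h y"]) (use h in \<open>auto intro!: continuous_intros\<close>)
qed

lemma free_lcs_basis:
  fixes L :: "'v::real_vector topology"
  assumes X: "tychonoff_space X" and free: "free_lcs X L i"
  shows "topspace L = span (i ` topspace X)" "independent (i ` topspace X)" "inj_on i (topspace X)"
proof -
  have fv: "free_lcs_wrt TYPE('v) X L i"
    by (rule free_lcs_wrt_embed[of X L i "\<lambda>x. (x, 0)" fst, OF free[unfolded free_lcs_def]])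
      (auto intro!: linearI)
  have fr: "free_lcs_wrt TYPE(real) X L i"
    by (rule free_lcs_wrt_embed[of X L i "\<lambda>x. (0, x)" snd, OF free[unfolded free_lcs_def]])
      (auto intro!: linearI)
  have L: "lcs L" and i: "continuous_map X L i"
    using fv by (auto simp: free_lcs_wrt_def)
  have iL: "i ` topspace X \<subseteq> topspace L"
    using i by (rule continuous_map_image_subset_topspace)
  let ?S = "span (i ` topspace X)"
  have SL: "?S \<subseteq> topspace L"
    using iL lcs_subspace[OF L] by (rule span_minimal)
  let ?M = "pullback_topology ?S id L"
  have M: "lcs ?M" "topspace ?M = ?S"
    using lcs_pullback[of L ?S id] SL L by auto
  have "continuous_map X ?M i"
    by (rule continuous_map_pullback') (auto simp: i span_base)
  then have "\<exists>!r. r \<in> clin L ?M \<and> (\<forall>x\<in>topspace X. r (i x) = i x)"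
    using fv M unfolding free_lcs_wrt_def by blast
  then obtain r where r: "r \<in> clin L ?M" "\<forall>x\<in>topspace X. r (i x) = i x"
    by blast
  have unique: "g = h" if "g \<in> clin L L" "h \<in> clin L L"
      "\<forall>x\<in>topspace X. g (i x) = i x" "\<forall>x\<in>topspace X. h (i x) = i x" for g h
    using fv L i that unfolding free_lcs_wrt_def by blast
  have "continuous_map ?M L id"
    using continuous_map_pullback[of L L id ?S id] by simp
  then have "r \<in> clin L L"
    using r(1) continuous_map_compose[of L ?M r L id] by (auto simp: clin_def)
  moreover have "(\<lambda>x. if x \<in> topspace L then id x else 0) \<in> clin L L"
    by (rule clinI) (auto simp: L)
  ultimately have "r = (\<lambda>x. if x \<in> topspace L then id x else 0)"
    by (rule unique) (use r(2) iL in auto)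
  moreover have "r ` topspace L \<subseteq> ?S"
    using r(1) M(2) continuous_map_image_subset_topspace[of L ?M r] by (auto simp: clin_def)
  ultimately show "topspace L = ?S"
    using SL by force
  have sep: "i x \<notin> span (i ` S)" if S: "finite S" "S \<subseteq> topspace X" "x \<in> topspace X" "x \<notin> S" for x S
  proof
    assume x: "i x \<in> span (i ` S)"
    obtain g where g: "continuous_map X euclideanreal g" "g x = 1" "\<And>y. y \<in> S \<Longrightarrow> g y = 0"
      using tychonoff_separate[OF X S] by blast
    then have "\<exists>!h. h \<in> clin L euclideanreal \<and> (\<forall>x\<in>topspace X. h (i x) = g x)"
      using fr lcs_real unfolding free_lcs_wrt_def by blast
    then obtain h where h: "h \<in> clin L euclideanreal" "\<forall>x\<in>topspace X. h (i x) = g x"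
      by blast
    have "subspace {v \<in> topspace L. h v = 0}"
      using clin_eq_subspace[OF L h(1), of "\<lambda>_. 0"] by (simp add: clin_def)
    moreover have "i ` S \<subseteq> {v \<in> topspace L. h v = 0}"
    proof clarify
      fix y assume y: "y \<in> S"
      then have "y \<in> topspace X" using S(2) by (rule subsetD[rotated])
      then show "i y \<in> topspace L \<and> h (i y) = 0"
        using h(2) g(3)[OF y] iL by (simp add: image_subset_iff)
    qed
    ultimately have "span (i ` S) \<subseteq> {v \<in> topspace L. h v = 0}"
      by (rule span_minimal[rotated])
    then have "h (i x) = 0" using x by blast
    then show False using h(2) g(2) S(3) by simp
  qed
  show inj: "inj_on i (topspace X)"
  proof (rule inj_onI, rule ccontr)
    fix x y assume "x \<in> topspace X" "y \<in> topspace X" "i x = i y" "x \<noteq> y"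
    then show False using sep[of "{y}" x] by (auto intro: span_base)
  qed
  show "independent (i ` topspace X)"
    unfolding dependent_def
  proof clarify
    fix x assume x: "x \<in> topspace X" "i x \<in> span (i ` topspace X - {i x})"
    obtain T r where T: "finite T" "T \<subseteq> i ` topspace X - {i x}" "i x = (\<Sum>a\<in>T. r a *\<^sub>R a)"
      using x(2) unfolding span_explicit by blast
    have "i x \<in> span T"
      unfolding T(3) by (intro span_sum span_scale span_base)
    moreover obtain S where "S \<subseteq> topspace X" "finite S" "T = i ` S"
      using finite_subset_image[OF T(1), of i "topspace X"] T(2) by blast
    ultimately show False using sep[of S x] T(2) x(1) by blast
  qed
qed

lemma graph_topology:
  assumes L: "lcs L" and E: "lcs E" and g: "linear g" "g ` topspace L \<subseteq> topspace E"
    and i: "continuous_map X L i" and f: "continuous_map X E f"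
    and gi: "\<And>x. x \<in> topspace X \<Longrightarrow> g (i x) = f x"
  defines "T \<equiv> pullback_topology (topspace L) (\<lambda>v. (v, g v)) (prod_topology L E)"
  shows "lcs T" "topspace T = topspace L" "continuous_map X T i"
    "continuous_map T L id" "continuous_map T E g"
proof -
  show "lcs T" "topspace T = topspace L"
    using lcs_pullback[of "prod_topology L E" "topspace L" "\<lambda>v. (v, g v)"] g(2) unfolding T_def
    by (auto intro!: lcs_prod L E lcs_subspace inj_onI
        simp: linear_add[OF g(1)] linear_scale[OF g(1)])
  have "continuous_map X (prod_topology L E) (\<lambda>x. (i x, f x))"
    by (intro continuous_map_pairedI i f)
  then have "continuous_map X (prod_topology L E) ((\<lambda>v. (v, g v)) \<circ> i)"
    by (rule continuous_map_eq) (auto simp: gi)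
  then show "continuous_map X T i"
    unfolding T_def
    by (rule continuous_map_pullback') (use continuous_map_image_subset_topspace[OF i] in auto)
  have "continuous_map T (prod_topology L E) (\<lambda>v. (v, g v))"
    using continuous_map_pullback[of "prod_topology L E" "prod_topology L E" id]
    by (simp add: T_def)
  from continuous_map_compose[OF this continuous_map_fst]
    continuous_map_compose[OF this continuous_map_snd]
  show "continuous_map T L id" "continuous_map T E g"
    by (simp_all add: o_def id_def)
qed

lemma unique_extension:
  assumes L: "lcs L" "topspace L = span (i ` topspace X)" and g: "linear g" "continuous_map L E g"
    and gi: "\<And>x. x \<in> topspace X \<Longrightarrow> g (i x) = f x"
  shows "\<exists>!g. g \<in> clin L E \<and> (\<forall>x\<in>topspace X. g (i x) = f x)"
proof (rule ex1I)
  show "(\<lambda>x. if x \<in> topspace L then g x else 0) \<in> clin L E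
      \<and> (\<forall>x\<in>topspace X. (if i x \<in> topspace L then g (i x) else 0) = f x)"
    using clinI[OF g(2) L(1)] gi
    by (simp add: linear_add[OF g(1)] linear_scale[OF g(1)] L(2) span_base)
  then show "h = (\<lambda>x. if x \<in> topspace L then g x else 0)"
    if "h \<in> clin L E \<and> (\<forall>x\<in>topspace X. h (i x) = f x)" for h
    using that by (intro clin_eqI[OF _ _ L]) auto
qed

theorem free_lcs_universal:
  fixes L :: "'v::real_vector topology" and E :: "'e::real_vector topology"
  assumes X: "tychonoff_space X" and free: "free_lcs X L i"
    and E: "lcs E" and f: "continuous_map X E f"
  shows "\<exists>!g. g \<in> clin L E \<and> (\<forall>x\<in>topspace X. g (i x) = f x)"
proof -
  have fv: "free_lcs_wrt TYPE('v) X L i"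
    by (rule free_lcs_wrt_embed[of X L i "\<lambda>x. (x, 0)" fst, OF free[unfolded free_lcs_def]])
      (auto intro!: linearI)
  have L: "lcs L" and i: "continuous_map X L i"
    using fv by (auto simp: free_lcs_wrt_def)
  note basis = free_lcs_basis[OF X free]
  obtain g where g: "linear g" "\<And>x. x \<in> topspace X \<Longrightarrow> g (i x) = f x"
    using linear_independent_extend[OF basis(2), of "f \<circ> inv_into (topspace X) i"]
      inv_into_f_f[OF basis(3)] by (auto simp: o_def)
  have "g ` topspace L = span (g ` i ` topspace X)"
    by (simp add: basis(1) linear_span_image[OF g(1)])
  also have "\<dots> \<subseteq> topspace E"
    using continuous_map_image_subset_topspace[OF f] g(2) lcs_subspace[OF E]
    by (intro span_minimal) auto
  finally have gE: "g ` topspace L \<subseteq> topspace E" .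
  let ?T = "pullback_topology (topspace L) (\<lambda>v. (v, g v)) (prod_topology L E)"
  note T = graph_topology[OF L E g(1) gE i f g(2)]
  have "\<exists>!h. h \<in> clin L ?T \<and> (\<forall>x\<in>topspace X. h (i x) = i x)"
    using fv T(1,3) unfolding free_lcs_wrt_def by blast
  then obtain h where h: "h \<in> clin L ?T" "\<forall>x\<in>topspace X. h (i x) = i x"
    by blast
  have "h \<in> clin L L"
    using h(1) continuous_map_compose[OF _ T(4), of L h] by (auto simp: clin_def)
  moreover have "(\<lambda>x. if x \<in> topspace L then id x else 0) \<in> clin L L"
    by (rule clinI) (auto simp: L)
  ultimately have hid: "h = (\<lambda>x. if x \<in> topspace L then id x else 0)"
    by (rule clin_eqI[OF _ _ L basis(1)]) (use h(2) in \<open>auto simp: basis(1) span_base\<close>)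
  have "continuous_map L E (g \<circ> h)"
    using continuous_map_compose[OF _ T(5)] h(1) by (auto simp: clin_def)
  then have "continuous_map L E g"
    by (rule continuous_map_eq) (auto simp: hid)
  then show ?thesis
    by (rule unique_extension[OF L basis(1) g(1) _ g(2)])
qed

theorem free_lcs_exists:
  fixes X :: "'a topology"
  assumes X: "tychonoff_space X"
  shows "\<exists>(L :: ('a \<Rightarrow> real) topology) i. free_lcs X L i"
proof -
  define i :: "'a \<Rightarrow> 'a \<Rightarrow> real" where "i = (\<lambda>x y. if y = x then 1 else 0)"
  define V where "V = span (i ` topspace X)"
  have V: "subspace V" by (simp add: V_def)
  have eval: "linear (\<lambda>v :: 'a \<Rightarrow> real. v x)" for x
    by (auto intro!: linearI)
  have ker: "v x = 0" if "v \<in> span (i ` S)" "x \<notin> S" for v x S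
    using linear_eq_0_on_span[OF eval[of x] _ that(1)] that(2) by (force simp: i_def)
  have "inj i"
    by (rule injI) (auto simp: i_def fun_eq_iff split: if_splits)
  then have inj: "inj_on i (topspace X)" by (rule inj_on_subset) simp
  have indep: "independent (i ` topspace X)"
    unfolding dependent_def
  proof clarify
    fix x assume "x \<in> topspace X" "i x \<in> span (i ` topspace X - {i x})"
    then have "i x \<in> span (i ` (topspace X - {x}))"
      using image_set_diff[OF \<open>inj i\<close>, of "topspace X" "{x}"] by simp
    then show False using ker[of "i x" _ x] by (force simp: i_def)
  qed
  have ext: "\<exists>g. linear g \<and> (\<forall>x\<in>topspace X. g (i x) = f x)" for f :: "'a \<Rightarrow> 'e::real_vector"
    using linear_independent_extend[OF indep, of "f \<circ> inv_into (topspace X) i"]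
      inv_into_f_f[OF inj] by (auto simp: o_def)
  obtain F :: "('a \<Rightarrow> real) \<Rightarrow> ('a \<Rightarrow> real) \<Rightarrow> real" where F: "\<And>f. linear (F f)"
      "\<And>f x. x \<in> topspace X \<Longrightarrow> F f (i x) = (if continuous_map X euclideanreal f then f x else 0)"
    using ext[of "\<lambda>x. if continuous_map X euclideanreal f then f x else 0" for f] by metis
  have sep: "\<exists>f. F f w \<noteq> 0" if w: "w \<in> V" "w \<noteq> 0" for w
  proof -
    obtain T r where T: "finite T" "T \<subseteq> i ` topspace X" "w = (\<Sum>a\<in>T. r a *\<^sub>R a)"
      using w(1) unfolding V_def span_explicit by blast
    then obtain S where S: "S \<subseteq> topspace X" "finite S" "T = i ` S"
      using finite_subset_image[OF T(1), of i "topspace X"] by blast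
    have wS: "w \<in> span (i ` S)"
      unfolding T(3) S(3) by (intro span_sum span_scale span_base)
    obtain x where x: "w x \<noteq> 0"
      using w(2) by (auto simp: fun_eq_iff)
    then have "x \<in> S" using ker[OF wS] by blast
    then obtain f where f: "continuous_map X euclideanreal f" "f x = 1" "\<And>y. y \<in> S - {x} \<Longrightarrow> f y = 0"
      using tychonoff_separate[OF X, of "S - {x}" x] S by auto
    have "F f w = w x"
    proof (rule linear_eq_on_span[OF F(1) eval _ wS])
      fix a assume "a \<in> i ` S"
      then obtain y where y: "y \<in> S" "a = i y" by blast
      then have "F f a = f y" using F(2)[of y f] f(1) S(1) by auto
      then show "F f a = a x" using f(2) f(3)[of y] y by (auto simp: i_def)
    qed
    with x show ?thesis by (intro exI[of _ f]) simp
  qed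
  define T0 where
    "T0 = pullback_topology V (\<lambda>v f. F f v) (product_topology (\<lambda>_. euclideanreal) UNIV)"
  have "inj_on (\<lambda>v f. F f v) V"
  proof (rule inj_onI, rule ccontr)
    fix u v assume uv: "u \<in> V" "v \<in> V" "(\<lambda>f. F f u) = (\<lambda>f. F f v)" "u \<noteq> v"
    then obtain f where "F f (u - v) \<noteq> 0"
      using sep[of "u - v"] subspace_diff[OF V] by auto
    then show False using fun_cong[OF uv(3), of f] by (simp add: linear_diff[OF F(1)])
  qed
  then have T0: "lcs T0" "topspace T0 = V"
    using lcs_pullback[OF lcs_product[OF lcs_real] V, of "\<lambda>v f. F f v"] unfolding T0_def
    by (auto simp: linear_add[OF F(1)] linear_scale[OF F(1)] fun_eq_iff)
  have "continuous_map X (product_topology (\<lambda>_. euclideanreal) UNIV) ((\<lambda>v f. F f v) \<circ> i)"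
    unfolding continuous_map_componentwise_UNIV
  proof
    fix f
    have "continuous_map X euclideanreal (\<lambda>x. if continuous_map X euclideanreal f then f x else 0)"
      by (cases "continuous_map X euclideanreal f") simp_all
    then show "continuous_map X euclideanreal (\<lambda>x. ((\<lambda>v f. F f v) \<circ> i) x f)"
      by (rule continuous_map_eq) (simp add: F(2))
  qed
  then have T0i: "continuous_map X T0 i"
    unfolding T0_def by (rule continuous_map_pullback') (auto simp: V_def span_base)
  define good where "good T \<longleftrightarrow> lcs T \<and> topspace T = V \<and> continuous_map X T i" for T
  define P where "P = (\<lambda>T. if good T then T else T0)"
  have P: "good (P T)" for T
    using T0 T0i by (simp add: P_def good_def)
  define L where "L = pullback_topology V (\<lambda>v T. v) (product_topology P UNIV)"
  have L: "lcs L" "topspace L = V"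
    using lcs_pullback[of "product_topology P UNIV" V "\<lambda>v T. v"] lcs_product[of P] P V
    unfolding L_def by (auto simp: good_def inj_on_def fun_eq_iff)
  have i: "continuous_map X L i"
    unfolding L_def
  proof (rule continuous_map_pullback')
    show "continuous_map X (product_topology P UNIV) ((\<lambda>v T. v) \<circ> i)"
      using P by (simp add: continuous_map_componentwise_UNIV o_def good_def)
  qed (auto simp: V_def span_base)
  have LT: "continuous_map L T id" if "good T" for T
  proof -
    have "continuous_map L (product_topology P UNIV) (\<lambda>v T. v)"
      using continuous_map_pullback[of "product_topology P UNIV" "product_topology P UNIV" id]
      by (simp add: L_def)
    then have "continuous_map L (P T) (\<lambda>v. v)"
      by (simp add: continuous_map_componentwise_UNIV)
    then show ?thesis using that by (simp add: P_def id_def)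
  qed
  have "\<exists>!g. g \<in> clin L E \<and> (\<forall>x\<in>topspace X. g (i x) = f x)"
    if E: "lcs E" and f: "continuous_map X E f" for E :: "(('a \<Rightarrow> real) \<times> real) topology" and f
  proof -
    obtain g where g: "linear g" "\<And>x. x \<in> topspace X \<Longrightarrow> g (i x) = f x"
      using ext[of f] by blast
    have "g ` topspace L = span (g ` i ` topspace X)"
      by (simp add: L(2) V_def linear_span_image[OF g(1)])
    also have "\<dots> \<subseteq> topspace E"
      using continuous_map_image_subset_topspace[OF f] g(2) lcs_subspace[OF E]
      by (intro span_minimal) auto
    finally have gE: "g ` topspace L \<subseteq> topspace E" .
    note T = graph_topology[where g = g and i = i and f = f, OF L(1) E g(1) gE i f g(2)]
    have "continuous_map L E g"
      using continuous_map_compose[OF LT T(5)] T(1-3) L(2) by (simp add: good_def)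
    then show ?thesis
      using L unfolding V_def
      by (intro unique_extension[where g = g and i = i and f = f] g) simp_all
  qed
  then have "free_lcs X L i"
    using L(1) i by (simp add: free_lcs_def free_lcs_wrt_def)
  then show ?thesis by blast
qed

end

theory Submission
  imports Defs "HOL-Probability.Discrete_Topology"
begin

text \<open>
  A functional on \<^term>\<open>L\<close> is determined by its restriction to the basis
  \<^term>\<open>i ` topspace X\<close>, and by the universal property every continuous real function on
  \<^term>\<open>X\<close> is such a restriction. So the dual of \<^term>\<open>L\<close> is the space of continuous real
  functions on \<^term>\<open>X\<close>, and the whole proof consists in reading the four barrelledness
  conditions as conditions on sets of continuous functions.

  Equicontinuity translates perfectly: a set of functionals that is pointwise bounded on
  \<^term>\<open>X\<close> is equicontinuous on \<^term>\<open>L\<close> iff its restrictions are equicontinuous at every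
  point of \<^term>\<open>X\<close> (\<open>pointwise_equicontinuous_imp_equicontinuous\<close> and
  \<open>equicontinuous_imp_pointwise_equicontinuous\<close>). In a P-space countably many neighbourhoods of
  a point can be intersected, so there a countable union of equicontinuous sets is equicontinuous
  as soon as it is pointwise bounded (\<open>P_space_imp_UN_equicontinuous\<close>). Strongly bounded sets,
  weak-* bounded sets and weak-* null sequences are all pointwise bounded, hence all four
  conditions hold when \<^term>\<open>X\<close> is a P-space.

  Conversely, let \<^term>\<open>f\<close> be a continuous real function on \<^term>\<open>X\<close> and compose it with the
  functions \<open>t \<mapsto> n t / (1 + (n t)\<^sup>2)\<close>, which are bounded by 1 and tend to zero pointwise
  but not uniformly near zero: whenever \<open>t \<noteq> 0\<close> is small, one of them is at least 1/4 in
  absolute value at \<open>t\<close>. The resulting functionals form a weak-* null sequence, and if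
  they are equicontinuous then \<^term>\<open>f\<close> has to vanish near each of its zeros. The sequence is
  moreover strongly bounded: a bounded subset of \<^term>\<open>L\<close> acts through \<^term>\<open>f\<close> on the Banach
  space of bounded continuous functions on the real line, and the uniform boundedness principle
  makes this action uniformly bounded (\<open>bounded_in_free_lcs_uniform\<close>). Each of the four
  conditions applies to this sequence, since it is strongly bounded, hence weak-* bounded, and a
  single functional is equicontinuous; so each forces all zero sets in \<^term>\<open>X\<close> to be open. Since in a completely regular space
  each point of a countable intersection of open sets lies in a zero set contained in the
  intersection, \<^term>\<open>X\<close> is then a P-space (\<open>P_space_if_zero_sets_open\<close>).
\<close>

section \<open>The uniform boundedness principle\<close>

text \<open>Baire's theorem: the closed sets of points at which the whole family is bounded by \<open>k\<close> cover the
  space, so one of them contains a ball, and by linearity a multiple of that bound holds on the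
  unit ball.\<close>

theorem uniform_boundedness:
  fixes F :: "('b::{real_normed_vector,complete_space} \<Rightarrow> 'c::real_normed_vector) set"
  assumes lin: "\<And>T. T \<in> F \<Longrightarrow> bounded_linear T"
    and ptw: "\<And>x. \<exists>K. \<forall>T\<in>F. norm (T x) \<le> K"
  obtains C where "C \<ge> 0" "\<And>T x. T \<in> F \<Longrightarrow> norm (T x) \<le> C * norm x"
proof -
  define D where "D k = {x. \<forall>T\<in>F. norm (T x) \<le> real k}" for k :: nat
  have closed: "closed (D k)" for k
  proof -
    have "D k = (\<Inter>T\<in>F. {x. norm (T x) \<le> real k})"
      by (auto simp: D_def)
    moreover have "closed {x. norm (T x) \<le> real k}" if "T \<in> F" for T
      by (intro closed_Collect_le continuous_on_norm continuous_on_const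
          bounded_linear.continuous_on[OF lin[OF that]] continuous_on_id)
    ultimately show ?thesis by auto
  qed
  have cover: "(\<Union>k. D k) = UNIV"
  proof (intro equalityI subsetI UNIV_I)
    fix x
    obtain K where "\<forall>T\<in>F. norm (T x) \<le> K" using ptw by blast
    moreover obtain k where "K \<le> real k" using real_arch_simple by blast
    ultimately have "x \<in> D k" by (auto simp: D_def intro: order_trans)
    then show "x \<in> (\<Union>k. D k)" by blast
  qed
  have "\<exists>k. interior (D k) \<noteq> {}"
  proof (rule ccontr)
    assume "\<not> (\<exists>k. interior (D k) \<noteq> {})"
    then have "euclidean interior_of \<Union> (range D) = {}"
      using closed
      by (intro Baire_category_alt)
        (auto simp: completely_metrizable_space_euclidean)
    then show False by (simp add: cover)
  qed
  then obtain k a where "a \<in> interior (D k)" by blast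
  then obtain e where e: "e > 0" "cball a e \<subseteq> D k"
    unfolding mem_interior_cball by blast
  show ?thesis
  proof (rule that)
    show "0 \<le> 2 * real k / e" using e by simp
    fix T x assume T: "T \<in> F"
    interpret T: bounded_linear T using T by (rule lin)
    show "norm (T x) \<le> 2 * real k / e * norm x"
    proof (cases "x = 0")
      case False
      define c where "c = e / norm x"
      have c: "c > 0" using False e by (simp add: c_def)
      \<comment> \<open>The factor \<open>c\<close> scales \<open>x\<close> to length \<open>e\<close>, so that a multiple of \<open>x\<close>
        is a difference of two points of the ball.\<close>
      have "a \<in> D k" "a + c *\<^sub>R x \<in> D k"
        using e False by (auto intro!: subsetD[OF e(2)] simp: dist_norm c_def)
      then have "norm (T a) \<le> k" "norm (T (a + c *\<^sub>R x)) \<le> k"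
        using T by (auto simp: D_def)
      moreover have "T (c *\<^sub>R x) = T (a + c *\<^sub>R x) - T a"
        by (simp add: T.add)
      ultimately have "norm (T (c *\<^sub>R x)) \<le> 2 * k"
        using norm_triangle_ineq4[of "T (a + c *\<^sub>R x)" "T a"] by simp
      then have "c * norm (T x) \<le> 2 * k"
        using c by (simp add: T.scaleR)
      then show ?thesis
        using c e False by (simp add: c_def field_simps)
    qed (simp add: T.zero)
  qed
qed


section \<open>Boundedness in a locally convex space and in its dual\<close>

lemma lcs_zero: "lcs E \<Longrightarrow> 0 \<in> topspace E"
  using subspace_0[OF lcs_subspace] by blast

lemma dual_add: "\<psi> \<in> dual E \<Longrightarrow> v \<in> topspace E \<Longrightarrow> w \<in> topspace E \<Longrightarrow> \<psi> (v + w) = \<psi> v + \<psi> w"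
  and dual_scale: "\<psi> \<in> dual E \<Longrightarrow> v \<in> topspace E \<Longrightarrow> \<psi> (c *\<^sub>R v) = c * \<psi> v"
  and dual_outside: "\<psi> \<in> dual E \<Longrightarrow> v \<notin> topspace E \<Longrightarrow> \<psi> v = 0"
  and dual_continuous: "\<psi> \<in> dual E \<Longrightarrow> continuous_map E euclideanreal \<psi>"
  by (auto simp: dual_def clin_def)

lemma dual_zero: "lcs E \<Longrightarrow> \<psi> \<in> dual E \<Longrightarrow> \<psi> 0 = 0"
  using dual_scale[of \<psi> E 0 0] lcs_zero[of E] by simp

lemma dual_diff:
  assumes "lcs E" "\<psi> \<in> dual E" "v \<in> topspace E" "w \<in> topspace E"
  shows "\<psi> (v - w) = \<psi> v - \<psi> w"
  using dual_add[OF assms(2,3), of "-1 *\<^sub>R w"] dual_scale[OF assms(2,4), of "-1"]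
    subspace_scale[OF lcs_subspace[OF assms(1)] assms(4), of "-1"] by simp

lemma zero_in_dual: "0 \<in> dual E"
  by (auto simp: dual_def clin_def zero_fun_def)

lemma scaleR_in_dual:
  assumes "\<psi> \<in> dual E" shows "c *\<^sub>R \<psi> \<in> dual E"
proof -
  have "continuous_map E euclideanreal (\<lambda>v. c * \<psi> v)"
    using dual_continuous[OF assms] by (intro continuous_intros)
  then show ?thesis
    using assms by (auto simp: dual_def clin_def scaleR_fun_def algebra_simps)
qed

text \<open>Scalar multiplication is continuous in the scalar, so a fixed vector divided by a large number
  enters any given neighbourhood of zero.\<close>

lemma bounded_in_singleton:
  assumes E: "lcs E" and v: "v \<in> topspace E"
  shows "bounded_in E {v}"
  unfolding bounded_in_def
proof (intro conjI allI impI)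
  fix U assume "nbhd_zero E U"
  then obtain W where W: "openin E W" "0 \<in> W" "W \<subseteq> U"
    by (auto simp: nbhd_zero_def)
  have "continuous_map euclideanreal E (\<lambda>c. c *\<^sub>R v)"
    using tvs_scaleR[of E euclideanreal "\<lambda>c. c" "\<lambda>_. v"] E v by (simp add: lcs_def)
  then have "open {c. c *\<^sub>R v \<in> W}"
    using W(1) by (auto dest: openin_continuous_map_preimage)
  moreover have "0 \<in> {c. c *\<^sub>R v \<in> W}" using W by simp
  ultimately obtain d where d: "d > 0" "ball 0 d \<subseteq> {c. c *\<^sub>R v \<in> W}"
    by (meson open_contains_ball)
  show "\<exists>s>0. \<forall>t\<ge>s. {v} \<subseteq> (\<lambda>x. t *\<^sub>R x) ` U"
  proof (intro exI[of _ "2 / d"] conjI allI impI)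
    fix t assume t: "2 / d \<le> t"
    have "t > 0" using d t by (smt (verit) divide_pos_pos)
    have "1 / t \<in> ball 0 d" using d(1) t \<open>t > 0\<close> by (simp add: field_simps)
    then have "(1 / t) *\<^sub>R v \<in> U" using d(2) W(3) by blast
    then show "{v} \<subseteq> (\<lambda>x. t *\<^sub>R x) ` U"
      using \<open>t > 0\<close> by (auto intro!: image_eqI[of _ _ "(1 / t) *\<^sub>R v"])
  qed (use d in simp)
qed (use v in simp)

text \<open>The bounded set is absorbed by the neighbourhood of zero on which \<open>l\<close> is below 1 in absolute
  value. Stating this for homogeneous maps makes it apply both to the members of the dual and to
  the evaluations \<open>\<lambda>\<psi>. \<psi> v\<close>, which do not vanish outside the dual.\<close>

lemma bounded_in_imp_functional_bounded:
  assumes B: "bounded_in E B" and E: "0 \<in> topspace E"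
    and hom: "\<And>c v. v \<in> topspace E \<Longrightarrow> l (c *\<^sub>R v) = c * l v"
    and l: "continuous_map E euclideanreal l"
  shows "\<exists>C. \<forall>v\<in>B. \<bar>l v\<bar> \<le> C"
proof -
  let ?U = "{v \<in> topspace E. l v \<in> ball 0 1}"
  have "openin E ?U"
    by (rule openin_continuous_map_preimage[OF l]) simp
  moreover have "l 0 = 0" using hom[OF E, of 0] by simp
  ultimately have "nbhd_zero E ?U"
    using E unfolding nbhd_zero_def by (intro conjI exI[of _ ?U]) auto
  then obtain s where s: "s > 0" "B \<subseteq> (\<lambda>x. s *\<^sub>R x) ` ?U"
    using B unfolding bounded_in_def by blast
  have "\<bar>l v\<bar> \<le> s" if v: "v \<in> B" for v
  proof -
    obtain u where "u \<in> ?U" "v = s *\<^sub>R u" using s(2) v by blast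
    then show ?thesis using s(1) by (simp add: hom abs_mult mult_le_cancel_left1)
  qed
  then show ?thesis by blast
qed

lemma strong_evaluation_continuous:
  assumes E: "lcs E"
  shows "continuous_map (strong E) euclideanreal (\<lambda>\<psi>. \<psi> v)"
proof (cases "v \<in> topspace E")
  case True
  have "strong_open E {\<psi> \<in> dual E. \<psi> v \<in> W}" if W: "open W" for W
    unfolding strong_open_def
  proof (intro conjI ballI)
    fix \<phi> assume "\<phi> \<in> {\<psi> \<in> dual E. \<psi> v \<in> W}"
    then obtain r where r: "r > 0" "cball (\<phi> v) r \<subseteq> W"
      using W by (auto simp: open_contains_cball)
    have "{\<psi> \<in> dual E. \<forall>x\<in>{v}. \<bar>\<psi> x - \<phi> x\<bar> \<le> r} \<subseteq> {\<psi> \<in> dual E. \<psi> v \<in> W}"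
      using r(2) by (auto simp: subset_iff dist_real_def abs_minus_commute)
    then show "\<exists>B r. bounded_in E B \<and> r > 0
        \<and> {\<psi> \<in> dual E. \<forall>x\<in>B. \<bar>\<psi> x - \<phi> x\<bar> \<le> r} \<subseteq> {\<psi> \<in> dual E. \<psi> v \<in> W}"
      using bounded_in_singleton[OF E True] r(1) by blast
  qed auto
  then show ?thesis
    by (auto simp: continuous_map_def openin_strong)
next
  case False
  have "continuous_map (strong E) euclideanreal (\<lambda>_. 0)" by simp
  then show ?thesis
    by (rule continuous_map_eq) (use False dual_outside in force)
qed

text \<open>A singleton is bounded, so convergence in the strong topology implies convergence at each vector.\<close>

lemma strong_finer_weak_star:
  assumes "lcs E" "openin (weak_star E) W"
  shows "openin (strong E) W"
proof -
  have "continuous_map (strong E) (weak_star E) id"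
    using strong_evaluation_continuous[OF assms(1)]
    by (auto simp: weak_star_def continuous_map_in_subtopology continuous_map_componentwise_UNIV)
  then have "openin (strong E) {x \<in> topspace (strong E). id x \<in> W}"
    using assms(2) by (rule openin_continuous_map_preimage)
  moreover have "{x \<in> topspace (strong E). id x \<in> W} = W"
    using openin_subset[OF assms(2)] by auto
  ultimately show ?thesis by simp
qed

lemma strong_bounded_imp_weak_star_bounded:
  assumes "lcs E" "bounded_in (strong E) A"
  shows "bounded_in (weak_star E) A"
proof -
  have "nbhd_zero (strong E) U" if "nbhd_zero (weak_star E) U" for U
    using that strong_finer_weak_star[OF assms(1)] by (auto simp: nbhd_zero_def)
  then show ?thesis using assms(2) by (auto simp: bounded_in_def)
qed

lemma weak_star_bounded_imp_pointwise_bounded: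
  assumes "bounded_in (weak_star E) A"
  shows "\<exists>C. \<forall>\<psi>\<in>A. \<bar>\<psi> v\<bar> \<le> C"
proof (rule bounded_in_imp_functional_bounded[OF assms])
  show "continuous_map (weak_star E) euclideanreal (\<lambda>\<psi>. \<psi> v)"
    unfolding weak_star_def
    by (intro continuous_map_from_subtopology continuous_map_product_projection) simp
qed (auto simp: zero_in_dual)

text \<open>If the functionals of \<open>A\<close> are bounded by \<open>C\<close> on \<open>B\<close>, then multiplying them by a number at most
  \<open>r / (\<bar>C\<bar> + 1)\<close> brings them below \<open>r\<close> on \<open>B\<close>, that is, into a basic strong neighbourhood of zero.\<close>

lemma strong_boundedI:
  assumes E: "lcs E" and A: "A \<subseteq> dual E"
    and bd: "\<And>B. bounded_in E B \<Longrightarrow> \<exists>C. \<forall>\<psi>\<in>A. \<forall>v\<in>B. \<bar>\<psi> v\<bar> \<le> C"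
  shows "bounded_in (strong E) A"
  unfolding bounded_in_def
proof (intro conjI allI impI)
  fix U assume "nbhd_zero (strong E) U"
  then obtain W where W: "strong_open E W" "0 \<in> W" "W \<subseteq> U"
    by (auto simp: nbhd_zero_def openin_strong)
  then obtain B r where B: "bounded_in E B" and r: "r > 0"
    and BU: "{\<psi> \<in> dual E. \<forall>x\<in>B. \<bar>\<psi> x - 0 x\<bar> \<le> r} \<subseteq> U"
    unfolding strong_open_def by (meson order_trans)
  obtain C where C: "\<forall>\<psi>\<in>A. \<forall>v\<in>B. \<bar>\<psi> v\<bar> \<le> C" using bd[OF B] by blast
  show "\<exists>s>0. \<forall>t\<ge>s. A \<subseteq> (\<lambda>x. t *\<^sub>R x) ` U"
  proof (intro exI[of _ "(\<bar>C\<bar> + 1) / r"] conjI allI impI subsetI)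
    fix t \<psi> assume t: "(\<bar>C\<bar> + 1) / r \<le> t" and \<psi>: "\<psi> \<in> A"
    have t0: "t > 0" using t r by (smt (verit) divide_pos_pos)
    have tr: "\<bar>C\<bar> + 1 \<le> t * r" using t r by (simp add: field_simps)
    have "\<bar>((1 / t) *\<^sub>R \<psi>) v\<bar> \<le> r" if v: "v \<in> B" for v
    proof -
      have "\<bar>\<psi> v\<bar> \<le> t * r" using C \<psi> v tr by fastforce
      then show ?thesis using t0 by (simp add: abs_mult field_simps)
    qed
    moreover have "(1 / t) *\<^sub>R \<psi> \<in> dual E"
      using \<psi> A by (blast intro: scaleR_in_dual)
    ultimately have "(1 / t) *\<^sub>R \<psi> \<in> U"
      using BU by auto
    then show "\<psi> \<in> (\<lambda>x. t *\<^sub>R x) ` U"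
      using t0 by (auto intro!: image_eqI[of _ _ "(1 / t) *\<^sub>R \<psi>"])
  qed (use r in \<open>auto intro: divide_pos_pos\<close>)
qed (use A in simp)

text \<open>The weak-* topology is induced by a product over all vectors of the ambient type; at those outside
  the space every functional is zero, so they do not affect the limit.\<close>

lemma weak_star_null_iff:
  fixes \<psi> :: "nat \<Rightarrow> 'v::real_vector \<Rightarrow> real"
  assumes "range \<psi> \<subseteq> dual E"
  shows "limitin (weak_star E) \<psi> 0 sequentially
    \<longleftrightarrow> (\<forall>v\<in>topspace E. (\<lambda>n. \<psi> n v) \<longlonglongrightarrow> 0)"
proof -
  have "(\<lambda>n. \<psi> n v) \<longlonglongrightarrow> 0" if "v \<notin> topspace E" for v
  proof -
    have "\<psi> n v = 0" for n using that assms dual_outside by blast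
    then show ?thesis by simp
  qed
  moreover have "\<psi> n \<in> dual E" for n using assms by blast
  ultimately show ?thesis
    by (auto simp: weak_star_def limitin_subtopology limitin_componentwise zero_in_dual)
qed


section \<open>Equicontinuity on a space and on its free locally convex space\<close>

definition pointwise_equicontinuous :: "'a topology \<Rightarrow> ('a \<Rightarrow> real) set \<Rightarrow> bool"
  where "pointwise_equicontinuous X F \<longleftrightarrow> (\<forall>x\<in>topspace X. \<forall>e>0. \<exists>N. openin X N \<and> x \<in> N
    \<and> (\<forall>y\<in>N. \<forall>f\<in>F. \<bar>f y - f x\<bar> \<le> e))"

lemma pointwise_equicontinuousE:
  assumes "pointwise_equicontinuous X F" "x \<in> topspace X" "e > 0"
  obtains N where "openin X N" "x \<in> N" "\<And>y f. y \<in> N \<Longrightarrow> f \<in> F \<Longrightarrow> \<bar>f y - f x\<bar> \<le> e"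
  using assms unfolding pointwise_equicontinuous_def by meson

lemma equicontinuous_singleton:
  assumes E: "lcs E" and \<psi>: "\<psi> \<in> dual E"
  shows "equicontinuous E {\<psi>}"
proof -
  let ?U = "{v \<in> topspace E. \<psi> v \<in> ball 0 1}"
  have "openin E ?U"
    by (rule openin_continuous_map_preimage[OF dual_continuous[OF \<psi>]]) simp
  then have "nbhd_zero E ?U"
    using lcs_zero[OF E] dual_zero[OF E \<psi>] unfolding nbhd_zero_def
    by (intro conjI exI[of _ ?U]) auto
  then show ?thesis
    using \<psi> unfolding equicontinuous_def polar_def by (intro exI[of _ ?U]) auto
qed

lemma equicontinuous_subset_dual: "equicontinuous E A \<Longrightarrow> A \<subseteq> dual E"
  by (auto simp: equicontinuous_def polar_def)

text \<open>If the functionals are bounded by 1 on a neighbourhood \<open>W\<close> of zero, they vary by at most \<open>e\<close>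
  between \<open>x\<close> and the points \<open>y\<close> with \<open>i y - i x\<close> in \<open>e W\<close>, and these form an open set.\<close>

lemma equicontinuous_imp_pointwise_equicontinuous:
  assumes L: "lcs L" and i: "continuous_map X L i" and A: "equicontinuous L A"
  shows "pointwise_equicontinuous X ((\<lambda>\<psi>. \<psi> \<circ> i) ` A)"
  unfolding pointwise_equicontinuous_def
proof (intro ballI allI impI)
  fix x and e :: real assume x: "x \<in> topspace X" and e: "e > 0"
  obtain U W where U: "A \<subseteq> polar L U" "openin L W" "0 \<in> W" "W \<subseteq> U"
    using A by (auto simp: equicontinuous_def nbhd_zero_def)
  have T: "tvs L" using L by (simp add: lcs_def)
  have iL: "i y \<in> topspace L" if "y \<in> topspace X" for y
    using continuous_map_image_subset_topspace[OF i] that by blast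
  note V = lcs_subspace[OF L]
  let ?h = "\<lambda>y. (1 / e) *\<^sub>R (i y + (- i x))"
  let ?N = "{y \<in> topspace X. ?h y \<in> W}"
  have "- i x \<in> topspace L" using iL[OF x] V by (simp add: subspace_neg)
  then have "continuous_map X L ?h"
    by (intro tvs_scaleR[OF T] tvs_add[OF T] i) simp_all
  then have "openin X ?N" using U(2) by (rule openin_continuous_map_preimage)
  moreover have "\<bar>\<psi> (i y) - \<psi> (i x)\<bar> \<le> e" if y: "y \<in> ?N" and \<psi>: "\<psi> \<in> A" for y \<psi>
  proof -
    have d: "\<psi> \<in> dual L" and "\<bar>\<psi> (?h y)\<bar> \<le> 1"
      using U(1,4) y \<psi> by (auto simp: polar_def)
    moreover have "\<psi> (?h y) = (1 / e) * (\<psi> (i y) - \<psi> (i x))"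
      using iL x y d by (simp add: dual_scale dual_diff[OF L] subspace_diff[OF V])
    ultimately have "\<bar>(1 / e) * (\<psi> (i y) - \<psi> (i x))\<bar> \<le> 1" by simp
    then show ?thesis using e by (simp add: abs_mult field_simps)
  qed
  ultimately show "\<exists>N. openin X N \<and> x \<in> N
      \<and> (\<forall>y\<in>N. \<forall>f\<in>(\<lambda>\<psi>. \<psi> \<circ> i) ` A. \<bar>f y - f x\<bar> \<le> e)"
    using U(3) x by (intro exI[of _ ?N]) auto
qed

lemma lcs_euclidean: "lcs (euclidean :: 'b::real_normed_vector topology)"
proof -
  have "continuous_map euclidean euclidean (\<lambda>z::'b \<times> 'b. fst z + snd z)"
    "continuous_map euclidean euclidean (\<lambda>z::real \<times> 'b. fst z *\<^sub>R snd z)"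
    by (auto intro!: continuous_intros)
  moreover have "neighbourhood_base_at (0::'b) convex euclidean"
    unfolding neighbourhood_base_at_def
  proof (intro allI impI)
    fix W :: "'b set" assume "openin euclidean W \<and> 0 \<in> W"
    then obtain e where "e > 0" "ball 0 e \<subseteq> W"
      by (auto simp: open_contains_ball)
    then show "\<exists>U V. openin euclidean U \<and> convex V \<and> 0 \<in> U \<and> U \<subseteq> V \<and> V \<subseteq> W"
      by (intro exI[of _ "ball 0 e"]) (auto simp: convex_ball)
  qed
  ultimately show ?thesis
    by (simp add: lcs_def tvs_def case_prod_unfold)
qed

lemma bounded_linear_apply_bcontfun:
  "bounded_linear (\<lambda>\<phi> :: 'a::topological_space \<Rightarrow>\<^sub>C 'b::real_normed_vector. apply_bcontfun \<phi> t)"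
  by (rule bounded_linear_intro[of _ 1]) (simp_all add: norm_bounded)

lemma free_lcs_lcs: "free_lcs X L i \<Longrightarrow> lcs L"
  and free_lcs_continuous: "free_lcs X L i \<Longrightarrow> continuous_map X L i"
  by (simp_all add: free_lcs_def free_lcs_wrt_def)

text \<open>The evaluation map sends a point \<open>x\<close> to the family of values \<open>\<psi> (i x)\<close>, indexed by the functionals
  \<open>\<psi>\<close> in \<open>A\<close>. Pointwise boundedness puts this family into the Banach space of bounded functions on
  \<open>A\<close> with the sup norm, and equicontinuity says exactly that the map is continuous. Its linear
  extension to the free space has the coordinates \<open>\<psi>\<close>, so all of \<open>A\<close> is bounded by 1 on the
  preimage of the unit ball, which is a neighbourhood of zero.\<close>

lemma pointwise_equicontinuous_imp_equicontinuous:
  fixes X :: "'a topology" and L :: "'v::real_vector topology"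
  assumes X: "tychonoff_space X" and free: "free_lcs X L i" and A: "A \<subseteq> dual L"
    and bd: "\<And>x. x \<in> topspace X \<Longrightarrow> \<exists>C. \<forall>\<psi>\<in>A. \<bar>\<psi> (i x)\<bar> \<le> C"
    and eq: "pointwise_equicontinuous X ((\<lambda>\<psi>. \<psi> \<circ> i) ` A)"
  shows "equicontinuous L A"
proof -
  note L = free_lcs_lcs[OF free]
  \<comment> \<open>Bounded functions on a set are modelled as bounded continuous functions
    on a discrete type, extended by zero off \<open>A\<close>.\<close>
  define h where "h x d = (if of_discrete d \<in> A then of_discrete d (i x) else 0)"
    for x and d :: "('v \<Rightarrow> real) discrete"
  define G where "G x = Bcontfun (h x)" for x
  have cont: "continuous_on UNIV k" for k :: "('v \<Rightarrow> real) discrete \<Rightarrow> real"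
    by (simp add: continuous_on_open_vimage open_discrete)
  have G: "apply_bcontfun (G x) = h x" if x: "x \<in> topspace X" for x
  proof -
    obtain C where C: "\<forall>\<psi>\<in>A. \<bar>\<psi> (i x)\<bar> \<le> C" using bd[OF x] by blast
    have "norm (h x d) \<le> \<bar>C\<bar>" for d
      using C by (force simp: h_def)
    then have "h x \<in> bcontfun" by (rule bcontfun_normI[OF cont])
    then show ?thesis by (simp add: G_def Bcontfun_inverse)
  qed
  have "continuous_map X Met_TC.mtopology G"
    unfolding Met_TC.continuous_map_to_metric
  proof (intro ballI allI impI)
    fix x and e :: real assume x: "x \<in> topspace X" and e: "e > 0"
    then have "e / 2 > 0" by simp
    with eq x obtain N where N: "openin X N" "x \<in> N"
        "\<And>y f. y \<in> N \<Longrightarrow> f \<in> (\<lambda>\<psi>. \<psi> \<circ> i) ` A \<Longrightarrow> \<bar>f y - f x\<bar> \<le> e / 2"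
      by (rule pointwise_equicontinuousE) blast
    have N': "\<bar>\<psi> (i y) - \<psi> (i x)\<bar> \<le> e / 2" if "y \<in> N" "\<psi> \<in> A" for y \<psi>
      using N(3)[OF that(1) imageI[OF that(2)]] by simp
    have "G y \<in> Met_TC.mball (G x) e" if y: "y \<in> N" for y
    proof -
      have yX: "y \<in> topspace X" using y N(1) openin_subset by blast
      have "dist (G y) (G x) \<le> e / 2"
      proof (rule dist_bound)
        fix d show "dist (G y d) (G x d) \<le> e / 2"
          using N'[OF y, of "of_discrete d"] e by (simp add: G x yX h_def dist_real_def)
      qed
      then show ?thesis using e by (simp add: dist_commute)
    qed
    then show "\<exists>U. openin X U \<and> x \<in> U \<and> (\<forall>y\<in>U. G y \<in> Met_TC.mball (G x) e)"
      using N by blast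
  qed
  then have "continuous_map X euclidean G" by simp
  from free_lcs_universal[OF X free lcs_euclidean this]
  obtain g where g: "g \<in> clin L euclidean" "\<And>x. x \<in> topspace X \<Longrightarrow> g (i x) = G x"
    by blast
  have gA: "g v (discrete \<psi>) = \<psi> v" if \<psi>: "\<psi> \<in> A" for v \<psi>
  proof -
    have "continuous_map euclidean euclideanreal
        (\<lambda>k :: ('v \<Rightarrow> real) discrete \<Rightarrow>\<^sub>C real. k (discrete \<psi>))"
      using linear_continuous_on[OF bounded_linear_apply_bcontfun] by simp
    then have "continuous_map L euclideanreal (\<lambda>v. g v (discrete \<psi>))"
      using g(1) continuous_map_compose unfolding clin_def o_def by blast
    then have "(\<lambda>v. g v (discrete \<psi>)) \<in> clin L euclideanreal"
      using g(1) by (simp add: clin_def)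
    moreover have "\<psi> \<in> clin L euclideanreal" using A \<psi> by (auto simp: dual_def)
    ultimately have "(\<lambda>v. g v (discrete \<psi>)) = \<psi>"
      by (rule clin_eqI[OF _ _ L free_lcs_basis(1)[OF X free]])
        (auto simp: g(2) G h_def discrete_inverse \<psi>)
    then show ?thesis by (rule fun_cong)
  qed
  let ?U = "{v \<in> topspace L. g v \<in> ball 0 1}"
  have "g 0 = 0"
    using g(1) lcs_zero[OF L] by (force simp: clin_def dest: spec[of _ "0::real"])
  moreover have "openin L ?U"
    by (rule openin_continuous_map_preimage[of L euclidean]) (use g(1) in \<open>auto simp: clin_def\<close>)
  ultimately have "nbhd_zero L ?U"
    using lcs_zero[OF L] unfolding nbhd_zero_def by (intro conjI exI[of _ ?U]) auto
  moreover have "\<bar>\<psi> v\<bar> \<le> 1" if "\<psi> \<in> A" "v \<in> ?U" for \<psi> v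
    using norm_bounded[of "g v" "discrete \<psi>"] gA[OF that(1)] that(2) by simp
  ultimately show ?thesis
    using A unfolding equicontinuous_def polar_def by (intro exI[of _ ?U]) blast
qed


section \<open>P-spaces\<close>

lemma P_space_pointwise_equicontinuous_UN:
  fixes F :: "nat \<Rightarrow> ('a \<Rightarrow> real) set"
  assumes X: "P_space X" and F: "\<And>n. pointwise_equicontinuous X (F n)"
  shows "pointwise_equicontinuous X (\<Union>n. F n)"
  unfolding pointwise_equicontinuous_def
proof (intro ballI allI impI)
  fix x and e :: real assume "x \<in> topspace X" "e > 0"
  then have "\<forall>n. \<exists>N. openin X N \<and> x \<in> N \<and> (\<forall>y\<in>N. \<forall>f\<in>F n. \<bar>f y - f x\<bar> \<le> e)"
    using F unfolding pointwise_equicontinuous_def by blast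
  then obtain N where N: "\<And>n. openin X (N n)" "\<And>n. x \<in> N n"
      "\<And>n y f. y \<in> N n \<Longrightarrow> f \<in> F n \<Longrightarrow> \<bar>f y - f x\<bar> \<le> e"
    by metis
  have "openin X (\<Inter>n. N n)" using X N(1) by (simp add: P_space_def)
  then show "\<exists>N. openin X N \<and> x \<in> N \<and> (\<forall>y\<in>N. \<forall>f\<in>\<Union>n. F n. \<bar>f y - f x\<bar> \<le> e)"
    using N(2,3) by (intro exI[of _ "\<Inter>n. N n"]) blast
qed

text \<open>Given open sets \<open>U n\<close> with a common point \<open>x\<close>, take functions that vanish at \<open>x\<close> and equal 1 off
  \<open>U n\<close>. The zero set of a uniformly convergent sum of nonnegative multiples of their truncated
  absolute values is the intersection of their zero sets, hence a zero set around \<open>x\<close> inside every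
  \<open>U n\<close>.\<close>

lemma P_space_if_zero_sets_open:
  fixes X :: "'a topology"
  assumes X: "completely_regular_space X"
    and zero: "\<And>f. continuous_map X euclideanreal f \<Longrightarrow> openin X {x \<in> topspace X. f x = 0}"
  shows "P_space X"
  unfolding P_space_def
proof (intro allI impI)
  fix U :: "nat \<Rightarrow> 'a set" assume U: "\<forall>n. openin X (U n)"
  show "openin X (\<Inter>n. U n)"
  proof (subst openin_subopen, rule ballI)
    fix x assume x: "x \<in> (\<Inter>n. U n)"
    have "\<exists>f. continuous_map X euclideanreal f \<and> f x = 0 \<and> f ` (topspace X - U n) \<subseteq> {1}" for n
      using X U x unfolding completely_regular_space_alt' by blast
    then obtain f where f: "\<And>n. continuous_map X euclideanreal (f n)" "\<And>n. f n x = 0"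
        "\<And>n y. y \<in> topspace X \<Longrightarrow> y \<notin> U n \<Longrightarrow> f n y = (1::real)"
      by (metis DiffI imageI singletonD subsetD)
    define g where "g n y = (1/2)^n * min 1 \<bar>f n y\<bar>" for n y
    have g: "\<bar>g n y\<bar> \<le> (1/2)^n" "g n y \<ge> 0" for n y
      by (auto simp: g_def abs_mult mult_le_cancel_left1)
    have geo: "summable (\<lambda>n. (1/2::real)^n)" by (rule summable_geometric) simp
    have sum: "summable (\<lambda>n. g n y)" for y
      by (rule summable_comparison_test'[OF geo]) (use g in simp)
    have "uniform_limit (topspace X) (\<lambda>n y. \<Sum>k<n. g k y) (\<lambda>y. suminf (\<lambda>k. g k y)) sequentially"
      by (rule Weierstrass_m_test[OF _ geo]) (use g in simp)
    then have lim: "\<forall>\<^sub>F n in sequentially. \<forall>y\<in>topspace X.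
        dist (\<Sum>k<n. g k y) (suminf (\<lambda>k. g k y)) < e" if "e > 0" for e
      using that by (auto simp: uniform_limit_iff)
    have gc: "continuous_map X euclideanreal (\<lambda>y. \<Sum>k<n. g k y)" for n
      unfolding g_def by (intro continuous_intros f(1)) auto
    have "continuous_map X euclideanreal (\<lambda>y. suminf (\<lambda>k. g k y))"
      using Met_TC.continuous_map_uniform_limit[where F = sequentially and X = X
          and f = "\<lambda>n y. \<Sum>k<n. g k y"] gc lim
      by simp
    then have "openin X {y \<in> topspace X. suminf (\<lambda>k. g k y) = 0}" by (rule zero)
    moreover have "x \<in> topspace X" using U x openin_subset by blast
    moreover have "{y \<in> topspace X. suminf (\<lambda>k. g k y) = 0} \<subseteq> (\<Inter>n. U n)"
    proof clarify
      fix y n assume y: "y \<in> topspace X" "suminf (\<lambda>k. g k y) = 0"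
      then have "g n y = 0" using suminf_eq_zero_iff[OF sum g(2)] by blast
      then show "y \<in> U n" using f(3)[OF y(1), of n] by (force simp: g_def)
    qed
    ultimately show "\<exists>T. openin X T \<and> x \<in> T \<and> T \<subseteq> (\<Inter>n. U n)"
      using f(2) by (intro exI[of _ "{y \<in> topspace X. suminf (\<lambda>k. g k y) = 0}"]) (simp add: g_def)
  qed
qed

lemma P_space_imp_UN_equicontinuous:
  fixes X :: "'a topology" and L :: "'v::real_vector topology" and A :: "nat \<Rightarrow> ('v \<Rightarrow> real) set"
  assumes X: "tychonoff_space X" "P_space X" and free: "free_lcs X L i"
    and A: "\<And>n. equicontinuous L (A n)"
    and bd: "\<And>x. x \<in> topspace X \<Longrightarrow> \<exists>C. \<forall>\<psi>\<in>\<Union>n. A n. \<bar>\<psi> (i x)\<bar> \<le> C"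
  shows "equicontinuous L (\<Union>n. A n)"
proof (rule pointwise_equicontinuous_imp_equicontinuous[OF X(1) free])
  show "(\<Union>n. A n) \<subseteq> dual L"
    using equicontinuous_subset_dual[OF A] by blast
  have "pointwise_equicontinuous X (\<Union>n. (\<lambda>\<psi>. \<psi> \<circ> i) ` A n)"
    by (intro P_space_pointwise_equicontinuous_UN X(2)
        equicontinuous_imp_pointwise_equicontinuous[OF free_lcs_lcs[OF free]
          free_lcs_continuous[OF free] A])
  then show "pointwise_equicontinuous X ((\<lambda>\<psi>. \<psi> \<circ> i) ` (\<Union>n. A n))"
    by (simp add: image_UN)
qed (rule bd)


section \<open>A null sequence of functionals that detects a zero set\<close>

lemma free_lcs_dual_extension:
  assumes "tychonoff_space X" "free_lcs X L i" "continuous_map X euclideanreal f"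
  shows "\<exists>\<psi>. \<psi> \<in> dual L \<and> (\<forall>x\<in>topspace X. \<psi> (i x) = f x)"
  using free_lcs_universal[OF assms(1,2) lcs_real assms(3)] unfolding dual_def by blast

text \<open>Expanding a vector in the Hamel basis shows that the value of a functional at it depends on
  finitely many values of the corresponding function on \<open>X\<close>. This is how pointwise
  convergence on \<open>X\<close> becomes weak-* convergence, and why the value at a vector depends
  continuously on the function in the sup norm.\<close>

lemma free_lcs_dual_eq_sum:
  fixes L :: "'v::real_vector topology"
  assumes X: "tychonoff_space X" and free: "free_lcs X L i" and v: "v \<in> topspace L"
  obtains S r where "finite S" "S \<subseteq> topspace X"
    "\<And>\<psi>. \<psi> \<in> dual L \<Longrightarrow> \<psi> v = (\<Sum>x\<in>S. r x * \<psi> (i x))"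
proof -
  note L = free_lcs_lcs[OF free]
  note V = lcs_subspace[OF L]
  have iL: "i x \<in> topspace L" if "x \<in> topspace X" for x
    using continuous_map_image_subset_topspace[OF free_lcs_continuous[OF free]] that by blast
  obtain T r where T: "finite T" "T \<subseteq> i ` topspace X" "v = (\<Sum>a\<in>T. r a *\<^sub>R a)"
    using v unfolding free_lcs_basis(1)[OF X free] span_explicit by blast
  obtain S where S: "S \<subseteq> topspace X" "finite S" "T = i ` S"
    using finite_subset_image[OF T(1,2)] by blast
  have inj: "inj_on i S"
    using free_lcs_basis(3)[OF X free] S(1) by (rule inj_on_subset)
  have vS: "v = (\<Sum>x\<in>S. r (i x) *\<^sub>R i x)"
    by (simp add: T(3) S(3) sum.reindex[OF inj])
  have "\<psi> (\<Sum>x\<in>S'. r (i x) *\<^sub>R i x) = (\<Sum>x\<in>S'. r (i x) * \<psi> (i x))"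
    if \<psi>: "\<psi> \<in> dual L" and "finite S'" "S' \<subseteq> topspace X" for \<psi> S'
    using that(2,3)
  proof induction
    case empty
    then show ?case by (simp add: dual_zero[OF L \<psi>])
  next
    case (insert x S')
    then have "(\<Sum>x\<in>S'. r (i x) *\<^sub>R i x) \<in> topspace L"
      by (intro subspace_sum[OF V] subspace_scale[OF V] iL) auto
    then show ?case
      using insert by (simp add: dual_add[OF \<psi>] dual_scale[OF \<psi>] iL subspace_scale[OF V])
  qed
  then show ?thesis
    using that[OF S(2,1), of "\<lambda>x. r (i x)"] S(1,2) vS by blast
qed

text \<open>Each vector of \<open>B\<close> defines a functional on the Banach space of bounded continuous functions
  \<open>\<phi>\<close> on the line, sending \<open>\<phi>\<close> to the value at the vector of the linear extension of \<open>\<phi> \<circ> f\<close>.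
  It is continuous because the vector has finite support. For fixed
  \<open>\<phi>\<close> these values are bounded over \<open>B\<close>, because a continuous functional
  is bounded on a bounded set; uniform boundedness then bounds them over \<open>B\<close> and the unit ball of
  \<open>\<phi>\<close> simultaneously.\<close>

lemma bounded_in_free_lcs_uniform:
  fixes L :: "'v::real_vector topology"
  assumes X: "tychonoff_space X" and free: "free_lcs X L i" and B: "bounded_in L B"
    and f: "continuous_map X euclideanreal f"
  shows "\<exists>C\<ge>0. \<forall>v\<in>B. \<forall>\<psi>\<in>dual L. \<forall>\<phi> :: real \<Rightarrow>\<^sub>C real.
    (\<forall>x\<in>topspace X. \<psi> (i x) = apply_bcontfun \<phi> (f x)) \<longrightarrow> \<bar>\<psi> v\<bar> \<le> C * norm \<phi>"
proof -
  note L = free_lcs_lcs[OF free]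
  have "\<exists>\<psi>. \<psi> \<in> dual L \<and> (\<forall>x\<in>topspace X. \<psi> (i x) = apply_bcontfun \<phi> (f x))"
    for \<phi> :: "real \<Rightarrow>\<^sub>C real"
  proof -
    have "continuous_map X euclideanreal (\<lambda>x. apply_bcontfun \<phi> (f x))"
      using continuous_map_compose[OF f, of euclideanreal "apply_bcontfun \<phi>"] by (simp add: o_def)
    then show ?thesis by (rule free_lcs_dual_extension[OF X free])
  qed
  then obtain E where E: "\<And>\<phi>. E \<phi> \<in> dual L"
      "\<And>\<phi> x. x \<in> topspace X \<Longrightarrow> E \<phi> (i x) = apply_bcontfun \<phi> (f x)"
    by metis
  let ?F = "(\<lambda>v \<phi>. E \<phi> v) ` B"
  have lin: "bounded_linear (\<lambda>\<phi>. E \<phi> v)" if v: "v \<in> B" for v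
  proof -
    have "v \<in> topspace L" using B v by (auto simp: bounded_in_def)
    then obtain S r where S: "finite S" "S \<subseteq> topspace X"
      "\<And>\<psi>. \<psi> \<in> dual L \<Longrightarrow> \<psi> v = (\<Sum>x\<in>S. r x * \<psi> (i x))"
      using free_lcs_dual_eq_sum[OF X free] by blast
    have "bounded_linear (\<lambda>\<phi>. \<Sum>x\<in>S. r x * apply_bcontfun \<phi> (f x))"
      by (intro bounded_linear_sum bounded_linear_const_mult bounded_linear_apply_bcontfun)
    moreover have "E \<phi> v = (\<Sum>x\<in>S. r x * apply_bcontfun \<phi> (f x))" for \<phi>
      using S(2) E by (simp add: S(3) subset_iff)
    ultimately show ?thesis by simp
  qed
  have ptw: "\<exists>K. \<forall>T\<in>?F. norm (T \<phi>) \<le> K" for \<phi>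
    using bounded_in_imp_functional_bounded[OF B lcs_zero[OF L] dual_scale[OF E(1)]
        dual_continuous[OF E(1)], of \<phi>] by auto
  obtain C where C: "C \<ge> 0" "\<And>T \<phi>. T \<in> ?F \<Longrightarrow> norm (T \<phi>) \<le> C * norm \<phi>"
    using uniform_boundedness[of ?F, OF _ ptw] lin by blast
  show ?thesis
  proof (intro exI[of _ C] conjI ballI allI impI C(1))
    fix v \<psi> and \<phi> :: "real \<Rightarrow>\<^sub>C real"
    assume v: "v \<in> B" and \<psi>: "\<psi> \<in> dual L" "\<forall>x\<in>topspace X. \<psi> (i x) = apply_bcontfun \<phi> (f x)"
    have "\<psi> = E \<phi>"
    proof (rule clin_eqI[OF _ _ L free_lcs_basis(1)[OF X free]])
      show "\<psi> \<in> clin L euclideanreal" "E \<phi> \<in> clin L euclideanreal"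
        using \<psi>(1) E(1) by (simp_all add: dual_def)
      show "\<psi> b = E \<phi> b" if "b \<in> i ` topspace X" for b
        using that \<psi>(2) E(2) by auto
    qed
    then show "\<bar>\<psi> v\<bar> \<le> C * norm \<phi>" using C(2) v by force
  qed
qed

text \<open>With \<open>s = n t\<close> this is \<open>s / (1 + s\<^sup>2)\<close>: for \<open>n > 0\<close> a bump of fixed height, with
  its mirror image for negative \<open>t\<close>, that moves into the origin as \<open>n\<close> grows, the
  standard sequence that converges pointwise but not uniformly.\<close>

definition hump :: "nat \<Rightarrow> real \<Rightarrow> real"
  where "hump n t = real n * t / (1 + (real n * t)\<^sup>2)"

lemma hump_0 [simp]: "hump n 0 = 0"
  by (simp add: hump_def)

lemma hump_bound: "\<bar>hump n t\<bar> \<le> 1"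
proof -
  have "\<bar>s\<bar> \<le> 1 + s\<^sup>2" for s :: real
    using zero_le_power2[of "\<bar>s\<bar> - 1"] by (simp add: power2_eq_square algebra_simps)
  moreover have "1 + s\<^sup>2 > 0" for s :: real
    by (smt (verit) zero_le_power2)
  ultimately show ?thesis
    by (simp add: hump_def abs_divide)
qed

lemma hump_bcontfun: "hump n \<in> bcontfun"
proof (rule bcontfun_normI)
  have "1 + s\<^sup>2 \<noteq> 0" for s :: real
    by (smt (verit) zero_le_power2)
  then show "continuous_on UNIV (hump n)"
    unfolding hump_def by (auto intro!: continuous_intros)
  show "norm (hump n t) \<le> 1" for t using hump_bound by simp
qed

lemma hump_tendsto_0: "(\<lambda>n. hump n t) \<longlonglongrightarrow> 0"
proof (cases "t = 0")
  case False
  have le: "norm (hump n t) \<le> inverse (\<bar>t\<bar> * real n)" for n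
  proof (cases "n = 0")
    case n: False
    define s where "s = real n * t"
    have "s \<noteq> 0" using n False by (simp add: s_def)
    then have "\<bar>s\<bar> / (1 + s\<^sup>2) \<le> \<bar>s\<bar> / s\<^sup>2"
      by (intro divide_left_mono) (auto simp: add_pos_nonneg)
    also have "\<dots> = inverse \<bar>s\<bar>"
      using \<open>s \<noteq> 0\<close> by (simp add: power2_eq_square field_simps)
    finally show ?thesis
      by (simp add: hump_def s_def[symmetric] abs_divide)
        (simp add: s_def abs_mult mult.commute)
  qed (simp add: hump_def)
  have "\<forall>\<^sub>F n in sequentially. norm (hump n t) \<le> inverse (\<bar>t\<bar> * real n)"
    using le by (intro always_eventually allI)
  moreover have "((\<lambda>n. inverse (\<bar>t\<bar> * real n)) \<longlongrightarrow> 0) sequentially"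
    using False
    by (intro tendsto_inverse_0_at_top filterlim_tendsto_pos_mult_at_top[OF tendsto_const]
        filterlim_real_sequentially) auto
  ultimately show ?thesis by (rule Lim_null_comparison)
qed simp

text \<open>For \<open>n = \<lfloor>1 / \<bar>t\<bar>\<rfloor>\<close> the number \<open>s = n \<bar>t\<bar>\<close> lies between 1/2 and 1, where \<open>s / (1 + s\<^sup>2)\<close> is at
  least 1/4.\<close>

lemma hump_ge:
  assumes "t \<noteq> 0" "\<bar>t\<bar> < 1"
  obtains n where "\<bar>hump n t\<bar> \<ge> 1 / 4"
proof -
  define n where "n = nat \<lfloor>1 / \<bar>t\<bar>\<rfloor>"
  have n: "real n \<le> 1 / \<bar>t\<bar>" "1 / \<bar>t\<bar> < real n + 1"
    unfolding n_def using assms(1) by (auto simp: of_nat_nat)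
  define s where "s = real n * \<bar>t\<bar>"
  have s1: "s \<le> 1" using n(1) assms(1) by (simp add: s_def field_simps)
  have "1 < s + \<bar>t\<bar>" using n(2) assms(1) by (simp add: s_def field_simps)
  moreover have "1 / \<bar>t\<bar> > 1" using assms by (simp add: field_simps)
  then have "n \<ge> 1" using n(2) by linarith
  then have "\<bar>t\<bar> \<le> s" by (simp add: s_def mult_le_cancel_right1)
  ultimately have s2: "1 / 2 \<le> s" by simp
  have "s\<^sup>2 \<le> 1" using s1 s2 by (simp add: power_le_one)
  then have "1 / 4 \<le> s / (1 + s\<^sup>2)"
    using s2 by (simp add: field_simps add_pos_nonneg)
  moreover have "\<bar>hump n t\<bar> = s / (1 + s\<^sup>2)"
    by (simp add: hump_def s_def abs_divide abs_mult power_mult_distrib)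
  ultimately show ?thesis using that[of n] by simp
qed

text \<open>One sequence serves all converse implications: it is small in every sense in which the
  barrelledness conditions ask for smallness, yet it notices every nonzero value of \<open>f\<close> near the
  zero set, since some member of it is at least 1/4 there in absolute
  value.\<close>

lemma free_lcs_zero_set_sequence:
  fixes X :: "'a topology" and L :: "'v::real_vector topology"
  assumes X: "tychonoff_space X" and free: "free_lcs X L i"
    and f: "continuous_map X euclideanreal f"
  shows "\<exists>\<psi> :: nat \<Rightarrow> 'v \<Rightarrow> real. range \<psi> \<subseteq> dual L
    \<and> bounded_in (strong L) (range \<psi>) \<and> limitin (weak_star L) \<psi> 0 sequentially
    \<and> (equicontinuous L (range \<psi>) \<longrightarrow> openin X {x \<in> topspace X. f x = 0})"
proof -
  note L = free_lcs_lcs[OF free]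
  have ap: "apply_bcontfun (Bcontfun (hump n)) = hump n" for n
    by (rule Bcontfun_inverse[OF hump_bcontfun])
  have "\<exists>\<psi>. \<psi> \<in> dual L \<and> (\<forall>x\<in>topspace X. \<psi> (i x) = hump n (f x))" for n
  proof -
    have "continuous_map X euclideanreal (\<lambda>x. hump n (f x))"
      using continuous_map_compose[OF f, of euclideanreal "hump n"] hump_bcontfun[of n]
      by (simp add: o_def bcontfun_def)
    then show ?thesis by (rule free_lcs_dual_extension[OF X free])
  qed
  then obtain \<psi> where \<psi>: "\<And>n. \<psi> n \<in> dual L" "\<And>n x. x \<in> topspace X \<Longrightarrow> \<psi> n (i x) = hump n (f x)"
    by metis
  have sub: "range \<psi> \<subseteq> dual L" using \<psi>(1) by blast
  show ?thesis
  proof (intro exI[of _ \<psi>] conjI impI)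
    show "bounded_in (strong L) (range \<psi>)"
    proof (rule strong_boundedI[OF L sub])
      fix B assume B: "bounded_in L B"
      obtain C where C: "C \<ge> 0" "\<forall>v\<in>B. \<forall>\<psi>\<in>dual L. \<forall>\<phi> :: real \<Rightarrow>\<^sub>C real.
          (\<forall>x\<in>topspace X. \<psi> (i x) = apply_bcontfun \<phi> (f x)) \<longrightarrow> \<bar>\<psi> v\<bar> \<le> C * norm \<phi>"
        using bounded_in_free_lcs_uniform[OF X free B f] by blast
      have "norm (Bcontfun (hump n)) \<le> 1" for n
        by (rule norm_bound) (simp add: ap hump_bound)
      then have "C * norm (Bcontfun (hump n)) \<le> C * 1" for n
        using C(1) by (rule mult_left_mono)
      moreover have "\<bar>\<psi> n v\<bar> \<le> C * norm (Bcontfun (hump n))" if "v \<in> B" for n v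
        using C(2) that \<psi> by (simp add: ap)
      ultimately have "\<bar>\<psi> n v\<bar> \<le> C * 1" if "v \<in> B" for n v
        using that by (meson order_trans)
      then show "\<exists>C. \<forall>\<psi>\<in>range \<psi>. \<forall>v\<in>B. \<bar>\<psi> v\<bar> \<le> C" by auto
    qed
    have "(\<lambda>n. \<psi> n v) \<longlonglongrightarrow> 0" if "v \<in> topspace L" for v
    proof -
      obtain S r where S: "finite S" "S \<subseteq> topspace X"
          "\<And>\<psi>. \<psi> \<in> dual L \<Longrightarrow> \<psi> v = (\<Sum>x\<in>S. r x * \<psi> (i x))"
        using free_lcs_dual_eq_sum[OF X free \<open>v \<in> topspace L\<close>] by blast
      have "(\<lambda>n. \<Sum>x\<in>S. r x * hump n (f x)) \<longlonglongrightarrow> (\<Sum>x\<in>S. r x * 0)"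
        by (intro tendsto_intros hump_tendsto_0)
      moreover have "\<psi> n v = (\<Sum>x\<in>S. r x * hump n (f x))" for n
        using S(2) \<psi> by (simp add: S(3) subset_iff)
      ultimately show ?thesis by simp
    qed
    then show "limitin (weak_star L) \<psi> 0 sequentially"
      using weak_star_null_iff[OF sub] by blast
    assume "equicontinuous L (range \<psi>)"
    then have eq: "pointwise_equicontinuous X ((\<lambda>\<psi>. \<psi> \<circ> i) ` range \<psi>)"
      by (rule equicontinuous_imp_pointwise_equicontinuous[OF L free_lcs_continuous[OF free]])
    show "openin X {x \<in> topspace X. f x = 0}"
    proof (subst openin_subopen, rule ballI)
      fix x assume x: "x \<in> {x \<in> topspace X. f x = 0}"
      then have "x \<in> topspace X" by simp
      moreover have "(1::real) / 8 > 0" by simp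
      ultimately obtain N where N: "openin X N" "x \<in> N"
          "\<And>y g. y \<in> N \<Longrightarrow> g \<in> (\<lambda>\<psi>. \<psi> \<circ> i) ` range \<psi> \<Longrightarrow> \<bar>g y - g x\<bar> \<le> 1 / 8"
        by (rule pointwise_equicontinuousE[OF eq]) blast
      let ?M = "N \<inter> {y \<in> topspace X. f y \<in> ball 0 1}"
      have "openin X {y \<in> topspace X. f y \<in> ball 0 1}"
        by (rule openin_continuous_map_preimage[OF f]) simp
      then have "openin X ?M" using N(1) by blast
      moreover have "f y = 0" if y: "y \<in> ?M" for y
      proof (rule ccontr)
        assume "f y \<noteq> 0"
        moreover have "\<bar>f y\<bar> < 1" using y by simp
        ultimately obtain n where "\<bar>hump n (f y)\<bar> \<ge> 1 / 4" by (rule hump_ge)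
        moreover have "\<bar>hump n (f y)\<bar> \<le> 1 / 8"
          using N(3)[of y "\<psi> n \<circ> i"] y x by (simp add: \<psi>(2))
        ultimately show False by simp
      qed
      then have "?M \<subseteq> {x \<in> topspace X. f x = 0}" by blast
      moreover have "x \<in> ?M" using N(2) x by simp
      ultimately show "\<exists>T. openin X T \<and> x \<in> T \<and> T \<subseteq> {x \<in> topspace X. f x = 0}"
        by blast
    qed
  qed (rule sub)
qed


section \<open>The equivalence\<close>

theorem theorem1p1:
  fixes X :: "'a topology" and L :: "'v::real_vector topology" and i :: "'a \<Rightarrow> 'v"
  assumes "tychonoff_space X" and "free_lcs X L i"
  shows "(linf_barrelled L \<longleftrightarrow> linf_quasibarrelled L)
    \<and> (linf_quasibarrelled L \<longleftrightarrow> c0_barrelled L)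
    \<and> (c0_barrelled L \<longleftrightarrow> aleph0_quasibarrelled L)
    \<and> (aleph0_quasibarrelled L \<longleftrightarrow> P_space X)"
proof -
  note L = free_lcs_lcs[OF assms(2)]
  have UN: "equicontinuous L (\<Union>n. A n)" if "P_space X" "\<And>n. equicontinuous L (A n)"
      "\<And>v. \<exists>C. \<forall>\<psi>\<in>\<Union>n. A n. \<bar>\<psi> v\<bar> \<le> C" for A :: "nat \<Rightarrow> ('v \<Rightarrow> real) set"
    using P_space_imp_UN_equicontinuous[OF assms(1) that(1) assms(2) that(2,3)] .
  have seq: "equicontinuous L (range \<psi>)" if P: "P_space X" and d: "range \<psi> \<subseteq> dual L"
      and bd: "\<And>v. \<exists>C. \<forall>n. \<bar>\<psi> n v\<bar> \<le> C" for \<psi> :: "nat \<Rightarrow> 'v \<Rightarrow> real"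
  proof -
    have "equicontinuous L (\<Union>n. {\<psi> n})"
      using d bd by (intro UN[OF P] equicontinuous_singleton[OF L]) auto
    moreover have "(\<Union>n. {\<psi> n}) = range \<psi>" by blast
    ultimately show ?thesis by simp
  qed
  have 1: "linf_barrelled L" if P: "P_space X"
    unfolding linf_barrelled_def
  proof (intro allI impI)
    fix \<psi> :: "nat \<Rightarrow> 'v \<Rightarrow> real" assume b: "bounded_in (weak_star L) (range \<psi>)"
    show "equicontinuous L (range \<psi>)"
      using b weak_star_bounded_imp_pointwise_bounded[OF b]
      by (intro seq[OF P]) (auto simp: bounded_in_def)
  qed
  have 2: "c0_barrelled L" if P: "P_space X"
    unfolding c0_barrelled_def
  proof (intro allI impI)
    fix \<psi> :: "nat \<Rightarrow> 'v \<Rightarrow> real"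
    assume \<psi>: "range \<psi> \<subseteq> dual L \<and> limitin (weak_star L) \<psi> 0 sequentially"
    have "\<exists>C. \<forall>n. \<bar>\<psi> n v\<bar> \<le> C" for v
    proof (cases "v \<in> topspace L")
      case True
      then have "(\<lambda>n. \<psi> n v) \<longlonglongrightarrow> 0" using \<psi> weak_star_null_iff by blast
      then have "Bseq (\<lambda>n. \<psi> n v)" by (intro convergent_imp_Bseq convergentI)
      then show ?thesis by (auto simp: Bseq_def)
    next
      case False
      then have "\<psi> n v = 0" for n using \<psi> dual_outside by blast
      then show ?thesis by auto
    qed
    then show "equicontinuous L (range \<psi>)" using \<psi> by (intro seq[OF P]) auto
  qed
  have 3: "aleph0_quasibarrelled L" if P: "P_space X"
    unfolding aleph0_quasibarrelled_def
  proof (intro allI impI)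
    fix A :: "nat \<Rightarrow> ('v \<Rightarrow> real) set"
    assume A: "(\<forall>n. equicontinuous L (A n)) \<and> bounded_in (strong L) (\<Union>n. A n)"
    then have "bounded_in (weak_star L) (\<Union>n. A n)"
      using strong_bounded_imp_weak_star_bounded[OF L] by blast
    then show "equicontinuous L (\<Union>n. A n)"
      using A weak_star_bounded_imp_pointwise_bounded by (intro UN[OF P]) blast+
  qed
  have 4: "linf_quasibarrelled L" if "linf_barrelled L"
    using that strong_bounded_imp_weak_star_bounded[OF L]
    unfolding linf_barrelled_def linf_quasibarrelled_def by blast
  have 5: "linf_quasibarrelled L" if q: "aleph0_quasibarrelled L"
    unfolding linf_quasibarrelled_def
  proof (intro allI impI)
    fix \<psi> :: "nat \<Rightarrow> 'v \<Rightarrow> real" assume b: "bounded_in (strong L) (range \<psi>)"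
    have "(\<Union>n. {\<psi> n}) = range \<psi>" by blast
    moreover have "equicontinuous L {\<psi> n}" for n
      using b by (intro equicontinuous_singleton[OF L]) (auto simp: bounded_in_def)
    ultimately show "equicontinuous L (range \<psi>)"
      using q b unfolding aleph0_quasibarrelled_def by metis
  qed
  have 6: "P_space X" if q: "linf_quasibarrelled L \<or> c0_barrelled L"
  proof (rule P_space_if_zero_sets_open)
    show "completely_regular_space X" using assms(1) by (simp add: tychonoff_space_def)
    fix f assume f: "continuous_map X euclideanreal f"
    obtain \<psi> :: "nat \<Rightarrow> 'v \<Rightarrow> real" where \<psi>: "range \<psi> \<subseteq> dual L"
        "bounded_in (strong L) (range \<psi>)" "limitin (weak_star L) \<psi> 0 sequentially"
        "equicontinuous L (range \<psi>) \<longrightarrow> openin X {x \<in> topspace X. f x = 0}"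
      using free_lcs_zero_set_sequence[OF assms f] by blast
    have "equicontinuous L (range \<psi>)"
      using q \<psi>(1-3) unfolding linf_quasibarrelled_def c0_barrelled_def by blast
    then show "openin X {x \<in> topspace X. f x = 0}" by (rule \<psi>(4)[rule_format])
  qed
  show ?thesis using 1 2 3 4 5 6 by blast
qed

end
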